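(* Let $(\mathcal S,\mathcal A)$ and $(\mathcal T,\mathcal B)$ be quantum graphs acting on finite-dimensional Hilbert spaces $H$ and $K$, respectively. The following are equivalent: (i) There is a non-degenerate TRO $\mathcal M\subseteq\mathcal B(H,K)$ which is also a $\mathcal B'$-$\mathcal A'$-bimodule and which implements both TRO-equivalences $\mathcal S\sim_{\mathrm{TRO}}\mathcal T$ and $\mathcal A\sim_{\mathrm{TRO}}\mathcal B$, that is, $\mathcal M^*\mathcal T\mathcal M\subseteq\mathcal S$, $\mathcal M\mathcal S\mathcal M^*\subseteq\mathcal T$, $\mathcal M^*\mathcal B\mathcal M\subseteq\mathcal A$ and $\mathcal M\mathcal A\mathcal M^*\subseteq\mathcal B$. (ii) There exists a faithful unital completely positive map $\varphi\colon\mathcal B\to\mathcal A$ such that $$\mathcal X_\varphi^*\mathcal T\mathcal X_\varphi\subseteq\mathcal S,\quad \mathcal X_\varphi\mathcal S\mathcal X_\varphi^*\subseteq\mathcal T\qquad\text{and}\qquad \mathcal X_\varphi^*\mathcal B\mathcal X_\varphi\subseteq\mathcal A,\quad \mathcal X_\varphi\mathcal A\mathcal X_\varphi^*\subseteq\mathcal B.$$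
   Context: An operator system in $\mathcal B(H)$ is a norm-closed selfadjoint linear subspace containing $I_H$. $[\,\cdot\,]$ denotes closed linear span; $\mathcal A'$ denotes the commutant of $\mathcal A$. For sets of operators, $\mathcal X^*\mathcal T\mathcal X$ denotes $\{x^*ty: x,y\in\mathcal X,\ t\in\mathcal T\}$, and similarly for other products. A quantum graph $(\mathcal S,\mathcal A)$ acting on a finite-dimensional Hilbert space $H$ consists of a von Neumann algebra $\mathcal A=\mathcal A''\subseteq\mathcal B(H)$ (with $I_H\in\mathcal A$) and an operator system $\mathcal S\subseteq\mathcal B(H)$ with $\mathcal A'\mathcal S\mathcal A'\subseteq\mathcal S$. A TRO is a norm-closed subspace $\mathcal M\subseteq\mathcal B(H,K)$ with $\mathcal M\mathcal M^*\mathcal M\subseteq\mathcal M$; it is non-degenerate if $I_H\in[\mathcal M^*\mathcal M]$ and $I_K\in[\mathcal M\mathcal M^*]$. It is a $\mathcal B'$-$\mathcal A'$-bimodule if $\mathcal B'\mathcal M\mathcal A'\subseteq\mathcal M$. For a unital completely positive map $\varphi\colon\mathcal B\to\mathcal A$ (where $\mathcal B\subseteq\mathcal B(K)$, $\mathcal A\subseteq\mathcal B(H)$), choose Kraus operators $v_1,\dots,v_r\in\mathcal B(H,K)$, i.e. $\varphi(b)=\sum_{i=1}^rv_i^*bv_i$ for all $b\in\mathcal B$, and set $$\mathcal X_\varphi:=\operatorname{span}\{bv_ia: b\in\mathcal B',\ a\in\mathcal A',\ i=1,\dots,r\}\subseteq\mathcal B(H,K).$$ This space does not depend on the choice of Kraus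 operators. The map $\varphi$ is faithful if $\varphi(x^*x)=0$ implies $x=0$. *)

theory Defs
  imports "HOL-Analysis.Analysis"
begin

text \<open>
  Finite-dimensional Hilbert spaces are \<open>complex ^ 'h\<close>, and an operator from
  \<open>complex ^ 'h\<close> to \<open>complex ^ 'k\<close> is its matrix of type \<open>complex ^ 'h ^ 'k\<close>. The norm of that type is
  the Hilbert-Schmidt norm, which is equivalent to the operator norm, so \<open>closed\<close> and \<open>closure\<close>
  refer to the operator norm topology. The library's \<open>span\<close> and \<open>subspace\<close> are
  real-linear; \<open>op.span\<close> and \<open>op.subspace\<close> below are their complex-linear versions.
\<close>

definition op_scale :: "complex \<Rightarrow> complex ^ 'n ^ 'm \<Rightarrow> complex ^ 'n ^ 'm"
  where "op_scale c x = (\<chi> i j. c * x $ i $ j)"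

interpretation op: vector_space "op_scale :: complex \<Rightarrow> complex ^ 'n ^ 'm \<Rightarrow> complex ^ 'n ^ 'm"
  by unfold_locales (simp_all add: op_scale_def vec_eq_iff algebra_simps)

definition cadj :: "complex ^ 'n ^ 'm \<Rightarrow> complex ^ 'm ^ 'n"
  where "cadj x = (\<chi> i j. cnj (x $ j $ i))"

definition cinner :: "complex ^ 'n \<Rightarrow> complex ^ 'n \<Rightarrow> complex"
  where "cinner \<xi> \<eta> = (\<Sum>i\<in>UNIV. cnj (\<xi> $ i) * \<eta> $ i)"

definition op_set_mult ::
    "(complex ^ 'n ^ 'm) set \<Rightarrow> (complex ^ 'p ^ 'n) set \<Rightarrow> (complex ^ 'p ^ 'm) set" (infixl "\<odot>" 75)
  where "X \<odot> Y = {x ** y | x y. x \<in> X \<and> y \<in> Y}"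

definition op_set_adj :: "(complex ^ 'n ^ 'm) set \<Rightarrow> (complex ^ 'm ^ 'n) set" ("_\<^sup>\<star>" [1000] 999)
  where "X\<^sup>\<star> = cadj ` X"

definition commutant :: "(complex ^ 'n ^ 'n) set \<Rightarrow> (complex ^ 'n ^ 'n) set"
  where "commutant A = {x. \<forall>a\<in>A. x ** a = a ** x}"

definition closed_span :: "(complex ^ 'n ^ 'm) set \<Rightarrow> (complex ^ 'n ^ 'm) set"
  where "closed_span X = closure (op.span X)"

definition operator_system :: "(complex ^ 'n ^ 'n) set \<Rightarrow> bool"
  where "operator_system S \<longleftrightarrow> op.subspace S \<and> closed S \<and> S\<^sup>\<star> \<subseteq> S \<and> mat 1 \<in> S"

definition von_neumann_algebra :: "(complex ^ 'n ^ 'n) set \<Rightarrow> bool"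
  where "von_neumann_algebra A \<longleftrightarrow>
    op.subspace A \<and> A \<odot> A \<subseteq> A \<and> A\<^sup>\<star> \<subseteq> A \<and> mat 1 \<in> A \<and> commutant (commutant A) = A"

definition quantum_graph :: "(complex ^ 'n ^ 'n) set \<Rightarrow> (complex ^ 'n ^ 'n) set \<Rightarrow> bool"
  where "quantum_graph S A \<longleftrightarrow>
    von_neumann_algebra A \<and> operator_system S \<and> commutant A \<odot> S \<odot> commutant A \<subseteq> S"

definition TRO :: "(complex ^ 'h ^ 'k) set \<Rightarrow> bool"
  where "TRO M \<longleftrightarrow> op.subspace M \<and> closed M \<and> M \<odot> M\<^sup>\<star> \<odot> M \<subseteq> M"

definition nondegenerate :: "(complex ^ 'h ^ 'k) set \<Rightarrow> bool"
  where "nondegenerate M \<longleftrightarrow> mat 1 \<in> closed_span (M\<^sup>\<star> \<odot> M) \<and> mat 1 \<in> closed_span (M \<odot> M\<^sup>\<star>)"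

definition bimodule ::
    "(complex ^ 'k ^ 'k) set \<Rightarrow> (complex ^ 'h ^ 'h) set \<Rightarrow> (complex ^ 'h ^ 'k) set \<Rightarrow> bool"
  where "bimodule D C M \<longleftrightarrow> D \<odot> M \<odot> C \<subseteq> M"

text \<open>
  An \<open>n\<times>n\<close> block matrix of operators on \<open>complex ^ 'h\<close> is given by its entries \<open>x i j\<close> with \<open>i, j < n\<close>;
  the sum below is the quadratic form of the operator on the \<open>n\<close>-fold direct sum. Maps between
  algebras are total functions of which only the values on \<open>B\<close> matter.
\<close>

definition block_positive :: "nat \<Rightarrow> (nat \<Rightarrow> nat \<Rightarrow> complex ^ 'h ^ 'h) \<Rightarrow> bool"
  where "block_positive n x \<longleftrightarrow>
    (\<forall>\<xi> :: nat \<Rightarrow> complex ^ 'h. (\<Sum>i<n. \<Sum>j<n. cinner (\<xi> i) (x i j *v \<xi> j)) \<in> \<real>\<^sub>\<ge>\<^sub>0)"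

definition linear_map_on ::
    "(complex ^ 'k ^ 'k) set \<Rightarrow> (complex ^ 'k ^ 'k \<Rightarrow> complex ^ 'h ^ 'h) \<Rightarrow> bool"
  where "linear_map_on B \<phi> \<longleftrightarrow>
    (\<forall>x\<in>B. \<forall>y\<in>B. \<phi> (x + y) = \<phi> x + \<phi> y) \<and> (\<forall>c. \<forall>x\<in>B. \<phi> (op_scale c x) = op_scale c (\<phi> x))"

definition completely_positive ::
    "(complex ^ 'k ^ 'k) set \<Rightarrow> (complex ^ 'k ^ 'k \<Rightarrow> complex ^ 'h ^ 'h) \<Rightarrow> bool"
  where "completely_positive B \<phi> \<longleftrightarrow>
    linear_map_on B \<phi> \<and>
    (\<forall>n x. (\<forall>i<n. \<forall>j<n. x i j \<in> B) \<and> block_positive n x \<longrightarrow>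
      block_positive n (\<lambda>i j. \<phi> (x i j)))"

definition ucp_map ::
    "(complex ^ 'k ^ 'k) set \<Rightarrow> (complex ^ 'h ^ 'h) set \<Rightarrow> (complex ^ 'k ^ 'k \<Rightarrow> complex ^ 'h ^ 'h) \<Rightarrow> bool"
  where "ucp_map B A \<phi> \<longleftrightarrow> \<phi> ` B \<subseteq> A \<and> completely_positive B \<phi> \<and> \<phi> (mat 1) = mat 1"

definition faithful :: "(complex ^ 'k ^ 'k) set \<Rightarrow> (complex ^ 'k ^ 'k \<Rightarrow> complex ^ 'h ^ 'h) \<Rightarrow> bool"
  where "faithful B \<phi> \<longleftrightarrow> (\<forall>x\<in>B. \<phi> (cadj x ** x) = 0 \<longrightarrow> x = 0)"

definition kraus_operators ::
    "(complex ^ 'k ^ 'k) set \<Rightarrow> (complex ^ 'k ^ 'k \<Rightarrow> complex ^ 'h ^ 'h) \<Rightarrow> nat \<Rightarrow>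
      (nat \<Rightarrow> complex ^ 'h ^ 'k) \<Rightarrow> bool"
  where "kraus_operators B \<phi> r v \<longleftrightarrow> (\<forall>b\<in>B. \<phi> b = (\<Sum>i<r. cadj (v i) ** b ** v i))"

text \<open>
  Completely positive maps on \<open>B\<close> have Kraus operators, and the span below is the same
  for all of them, so \<open>SOME\<close> selects a well-defined space.
\<close>

definition kraus_space ::
    "(complex ^ 'k ^ 'k) set \<Rightarrow> (complex ^ 'h ^ 'h) set \<Rightarrow> (complex ^ 'k ^ 'k \<Rightarrow> complex ^ 'h ^ 'h) \<Rightarrow>
      (complex ^ 'h ^ 'k) set"
  where "kraus_space B A \<phi> =
    (SOME X. \<exists>r v. kraus_operators B \<phi> r v \<and>
      X = op.span {b ** v i ** a | b i a. b \<in> commutant B \<and> i < r \<and> a \<in> commutant A})"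

end

theory Submission
  imports Defs
begin

text \<open>
  For \<open>(i) \<Longrightarrow> (ii)\<close> take a finite spanning family \<open>v\<^sub>i\<close> of \<open>M\<close>. Non-degeneracy makes
  \<open>P = \<Sum> v\<^sub>i* v\<^sub>i\<close> a positive definite element of the algebra \<open>[M* M]\<close>, which also contains some \<open>G\<close>
  with \<open>G* P G = 1\<close>. The operators \<open>w\<^sub>i = v\<^sub>i G \<in> M\<close> define \<open>\<phi>\<close>, and every other choice of Kraus
  operators of \<open>\<phi>\<close> lies in \<open>M\<close> as well, since \<open>M\<close> is a left \<open>B'\<close>-module and \<open>B'' = B\<close>.

  For \<open>(ii) \<Longrightarrow> (i)\<close> let \<open>X\<close> be the Kraus space. Since \<open>1 = \<Sum> v\<^sub>i* v\<^sub>i\<close>, one has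
  \<open>S X* X \<subseteq> [X* (X S X*) X] \<subseteq> S\<close>, so \<open>X* X\<close> is contained in the selfadjoint algebra \<open>C\<close> of those elements of \<open>A\<close>
  that multiply \<open>S\<close> into itself from both sides, and \<open>M = [X C]\<close> is the required TRO. The unit \<open>p\<close> of
  \<open>[M M*]\<close> lies in \<open>B\<close> and \<open>\<phi>(1 - p) = 0\<close>, so faithfulness gives the second half of
  non-degeneracy.

  Kraus operators of a unital completely positive map exist because \<open>\<phi>\<close>, suitably normalised, cannot be separated
  from the compact convex hull of the maps \<open>b \<mapsto> v* b v\<close> with \<open>\<parallel>v\<parallel> = 1\<close>: a separating
  functional is \<open>\<psi> \<mapsto> Re (\<Sum>\<^sub>i\<^sub>j \<psi>(y\<^sub>i\<^sub>j)\<^sub>i\<^sub>j)\<close> for a block matrix \<open>y\<close> over \<open>B\<close>, which its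
  values on the maps \<open>b \<mapsto> v* b v\<close> force to have positive real part.
\<close>

section \<open>Matrices and the Hilbert-Schmidt form\<close>

lemma cadj_nth [simp]: "cadj x $ i $ j = cnj (x $ j $ i)"
  by (simp add: cadj_def)

lemma op_scale_nth [simp]: "op_scale c x $ i $ j = c * x $ i $ j"
  by (simp add: op_scale_def)

lemma cadj_cadj [simp]: "cadj (cadj x) = x"
  by (simp add: vec_eq_iff)

lemma cadj_zero [simp]: "cadj 0 = 0"
  by (simp add: vec_eq_iff)

lemma cadj_one [simp]: "cadj (mat 1) = mat 1"
  by (auto simp: vec_eq_iff mat_def)

lemma cadj_add: "cadj (x + y) = cadj x + cadj y"
  by (simp add: vec_eq_iff)

lemma cadj_diff: "cadj (x - y) = cadj x - cadj y"
  by (simp add: vec_eq_iff)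

lemma cadj_sum: "cadj (sum f I) = (\<Sum>i\<in>I. cadj (f i))"
  by (simp add: vec_eq_iff)

lemma cadj_scale: "cadj (op_scale c x) = op_scale (cnj c) (cadj x)"
  by (simp add: vec_eq_iff)

lemma cadj_scaleR: "cadj (r *\<^sub>R x) = r *\<^sub>R cadj x"
  by (simp add: vec_eq_iff)

lemma cadj_mult: "cadj (x ** y) = cadj y ** cadj x"
  by (simp add: vec_eq_iff matrix_matrix_mult_def mult.commute)

lemma scaleR_eq_op_scale: "r *\<^sub>R x = op_scale (of_real r) x"
  by (simp add: vec_eq_iff complex_eq_iff)

lemma op_scale_mult_left: "op_scale c x ** y = op_scale c (x ** y)"
  by (simp add: vec_eq_iff matrix_matrix_mult_def sum_distrib_left mult.assoc)

lemma op_scale_mult_right: "x ** op_scale c y = op_scale c (x ** y)"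
  by (simp add: vec_eq_iff matrix_matrix_mult_def sum_distrib_left mult_ac)

lemma matrix_add_rdistrib: "(x + y) ** z = x ** z + y ** (z :: complex ^ 'a ^ 'b)"
  by (simp add: vec_eq_iff matrix_matrix_mult_def sum.distrib algebra_simps)

lemma matrix_diff_ldistrib: "z ** (x - y) = z ** x - z ** (y :: complex ^ 'a ^ 'b)"
  by (simp add: vec_eq_iff matrix_matrix_mult_def sum_subtractf algebra_simps)

lemma matrix_diff_rdistrib: "(x - y) ** z = x ** z - y ** (z :: complex ^ 'a ^ 'b)"
  by (simp add: vec_eq_iff matrix_matrix_mult_def sum_subtractf algebra_simps)

lemma matrix_mult_zero [simp]:
  "x ** 0 = 0" "0 ** (x :: complex ^ 'a ^ 'b) = 0"
  by (simp_all add: vec_eq_iff matrix_matrix_mult_def)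

lemma matrix_sum_mult: "sum f I ** z = (\<Sum>i\<in>I. f i ** (z :: complex ^ 'a ^ 'b))"
  by (induction I rule: infinite_finite_induct) (simp_all add: matrix_add_rdistrib)

lemma matrix_mult_sum_right: "z ** sum f I = (\<Sum>i\<in>I. z ** (f i :: complex ^ 'a ^ 'b))"
  by (induction I rule: infinite_finite_induct) (simp_all add: matrix_add_ldistrib)

lemma op_subspace_imp_subspace: "op.subspace V \<Longrightarrow> subspace V"
  unfolding subspace_def op.subspace_def scaleR_eq_op_scale by blast

lemma closed_op_subspace: "op.subspace V \<Longrightarrow> closed V"
  by (rule closed_subspace) (rule op_subspace_imp_subspace)

lemma closed_span_eq_span: "closed_span X = op.span X"
  unfolding closed_span_def by (rule closure_closed) (rule closed_op_subspace, rule op.subspace_span)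

section \<open>The complex Hilbert-Schmidt form and its orthogonal projections\<close>

definition hs :: "complex ^ 'n ^ 'm \<Rightarrow> complex ^ 'n ^ 'm \<Rightarrow> complex"
  where "hs x y = (\<Sum>i\<in>UNIV. \<Sum>j\<in>UNIV. cnj (x $ i $ j) * y $ i $ j)"

lemma hs_add_right: "hs z (x + y) = hs z x + hs z y"
  by (simp add: hs_def sum.distrib algebra_simps)

lemma hs_diff_left: "hs (x - y) z = hs x z - hs y z"
  by (simp add: hs_def sum_subtractf algebra_simps)

lemma hs_diff_right: "hs z (x - y) = hs z x - hs z y"
  by (simp add: hs_def sum_subtractf algebra_simps)

lemma hs_scale_left: "hs (op_scale c x) y = cnj c * hs x y"
  by (simp add: hs_def sum_distrib_left mult.assoc)

lemma hs_scale_right: "hs x (op_scale c y) = c * hs x y"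
  by (simp add: hs_def sum_distrib_left mult_ac)

lemma inner_eq_Re_hs: "inner x y = Re (hs x y)"
  by (simp add: hs_def inner_vec_def inner_complex_def)

lemma hs_self: "hs x x = of_real ((norm x)\<^sup>2)"
proof -
  have "Im (hs x x) = 0"
    by (simp add: hs_def mult.commute)
  moreover have "Re (hs x x) = (norm x)\<^sup>2"
    by (simp add: power2_norm_eq_inner inner_eq_Re_hs)
  ultimately show ?thesis
    by (simp add: complex_eq_iff)
qed

lemma hs_self_eq_0 [simp]: "hs x x = 0 \<longleftrightarrow> x = 0"
  by (simp add: hs_self)

lemma hs_trace: "hs x y = trace (cadj x ** y)"
  unfolding hs_def trace_def matrix_matrix_mult_def by (simp, rule sum.swap)

lemma hs_mult_left: "hs (d ** x) y = hs x (cadj d ** y)"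
  by (simp add: hs_trace cadj_mult matrix_mul_assoc)

lemma hs_mult_right: "hs (x ** d) y = hs x (y ** cadj d)"
  by (simp add: hs_trace cadj_mult matrix_mul_assoc) (metis matrix_mul_assoc trace_mul_sym)

lemma cadj_mult_self_eq_0: "cadj x ** x = 0 \<Longrightarrow> x = 0"
  by (metis hs_self_eq_0 hs_trace trace_0 mat_0)

text \<open>The real orthogonal decomposition only makes \<open>Re (hs u z)\<close> vanish; as
  \<open>V\<close> is closed under multiplication by \<open>\<i>\<close>, the whole complex form
  vanishes.\<close>

lemma hs_projection:
  fixes V :: "(complex ^ 'n ^ 'm) set"
  assumes V: "op.subspace V"
  obtains Q where "\<And>x. Q x \<in> V" "\<And>x y. Q (x + y) = Q x + Q y"
    "\<And>c x. Q (op_scale c x) = op_scale c (Q x)" "\<And>v. v \<in> V \<Longrightarrow> Q v = v"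
    "\<And>u x. u \<in> V \<Longrightarrow> hs u (x - Q x) = 0"
proof -
  have ex: "\<exists>v\<in>V. \<forall>u\<in>V. hs u (x - v) = 0" for x
  proof -
    obtain y z where y: "y \<in> span V" and z: "\<And>w. w \<in> span V \<Longrightarrow> orthogonal z w"
      and x: "x = y + z"
      by (metis orthogonal_subspace_decomp_exists)
    have sp: "span V = V"
      using op_subspace_imp_subspace[OF V] by (rule span_eq_iff[THEN iffD2])
    have re: "Re (hs u z) = 0" if "u \<in> V" for u
      using z[of u] that sp by (simp add: orthogonal_def inner_commute inner_eq_Re_hs)
    have ort: "hs u z = 0" if "u \<in> V" for u
    proof -
      have "op_scale \<i> u \<in> V"
        using V that by (simp add: op.subspace_scale)
      from re[OF this] re[OF that] show ?thesis
        by (simp add: hs_scale_left complex_eq_iff)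
    qed
    show ?thesis by (rule bexI[of _ y]) (use x y sp ort in auto)
  qed
  define Q where "Q x = (SOME v. v \<in> V \<and> (\<forall>u\<in>V. hs u (x - v) = 0))" for x
  have Q: "Q x \<in> V \<and> (\<forall>u\<in>V. hs u (x - Q x) = 0)" for x
    unfolding Q_def by (rule someI_ex) (use ex[of x] in blast)
  \<comment> \<open>The orthogonality condition determines the value, so each algebraic law of
    \<open>Q\<close> follows by verifying that condition for the expected value.\<close>
  have uniq: "v = Q x" if "v \<in> V" "\<And>u. u \<in> V \<Longrightarrow> hs u (x - v) = 0" for v x
  proof -
    have m: "v - Q x \<in> V"
      using V Q[of x] that(1) by (simp add: op.subspace_diff)
    have "hs (v - Q x) (v - Q x) = hs (v - Q x) (x - Q x) - hs (v - Q x) (x - v)"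
      by (simp add: hs_diff_right)
    also have "\<dots> = 0" using m Q[of x] that(2) by simp
    finally show ?thesis by simp
  qed
  show thesis
  proof (rule that)
    show "Q (x + y) = Q x + Q y" for x y
      by (rule uniq[symmetric])
        (use Q[of x] Q[of y] V in \<open>auto simp: op.subspace_add add_diff_add hs_add_right\<close>)
    show "Q (op_scale c x) = op_scale c (Q x)" for c x
      by (rule uniq[symmetric])
        (use Q[of x] V in \<open>auto simp: op.subspace_scale op.scale_right_diff_distrib[symmetric] hs_scale_right\<close>)
    show "Q v = v" if "v \<in> V" for v
      by (rule uniq[symmetric]) (use that in \<open>auto simp: hs_def\<close>)
  qed (use Q in auto)
qed

section \<open>Matrix units, matrix entries as inner products, commutants\<close>

definition munit :: "'m \<Rightarrow> 'n \<Rightarrow> complex ^ 'n ^ 'm"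
  where "munit i j = (\<chi> p q. if p = i \<and> q = j then 1 else 0)"

lemma munit_decomp: "x = (\<Sum>i\<in>UNIV. \<Sum>j\<in>UNIV. op_scale (x $ i $ j) (munit i j))"
proof -
  have *: "(\<Sum>i\<in>UNIV. \<Sum>j\<in>UNIV. x $ i $ j * (if p = i \<and> q = j then 1 else 0)) = x $ p $ q" for p q
  proof -
    have "(\<Sum>j\<in>UNIV. x $ i $ j * (if p = i \<and> q = j then 1 else 0)) = (if p = i then x $ i $ q else 0)" for i
      by (cases "p = i") (auto simp: if_distrib cong: if_cong)
    then show ?thesis by simp
  qed
  show ?thesis
    by (simp add: vec_eq_iff munit_def *)
qed

lemma op_linear_munit:
  fixes x :: "complex ^ 'n ^ 'm" and Q :: "complex ^ 'n ^ 'm \<Rightarrow> complex ^ 'q ^ 'p"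
  assumes "\<And>x y. Q (x + y) = Q x + Q y" "\<And>c x. Q (op_scale c x) = op_scale c (Q x)"
  shows "Q x = (\<Sum>i\<in>UNIV. \<Sum>j\<in>UNIV. op_scale (x $ i $ j) (Q (munit i j)))"
proof -
  have Q0: "Q 0 = 0" using assms(1)[of 0 0] by simp
  have Qs: "Q (sum f I) = (\<Sum>i\<in>I. Q (f i))" for f :: "'n \<Rightarrow> _" and I
    by (induction I rule: infinite_finite_induct) (simp_all add: Q0 assms(1))
  have Qs': "Q (sum f I) = (\<Sum>i\<in>I. Q (f i))" for f :: "'m \<Rightarrow> _" and I
    by (induction I rule: infinite_finite_induct) (simp_all add: Q0 assms(1))
  show ?thesis
    by (subst munit_decomp[of x]) (simp only: Qs Qs' assms(2))
qed

lemma conj_entry: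
  "(cadj v ** m ** v) $ i $ j = cinner (column i v) (m *v column j v)"
  unfolding matrix_mul_assoc[symmetric] 
  by (simp add: cinner_def matrix_matrix_mult_def matrix_vector_mult_def column_def)

lemma cinner_adj: "cinner x (m *v y) = cinner (cadj m *v x) y"
  unfolding cinner_def matrix_vector_mult_def
  by (simp add: sum_distrib_left sum_distrib_right mult_ac) (rule sum.swap)

lemma commutantI: "(\<And>a. a \<in> A \<Longrightarrow> x ** a = a ** x) \<Longrightarrow> x \<in> commutant A"
  by (simp add: commutant_def)

lemma commutantD: "x \<in> commutant A \<Longrightarrow> a \<in> A \<Longrightarrow> x ** a = a ** x"
  by (simp add: commutant_def)

lemma one_commutant [simp]: "mat 1 \<in> commutant A"
  by (simp add: commutant_def)

lemma cadj_commutant: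
  assumes "A\<^sup>\<star> \<subseteq> A" "x \<in> commutant A"
  shows "cadj x \<in> commutant A"
proof (rule commutantI)
  fix a assume "a \<in> A"
  then have "cadj a \<in> A" using assms(1) by (auto simp: op_set_adj_def)
  then have "cadj (x ** cadj a) = cadj (cadj a ** x)" using commutantD[OF assms(2)] by simp
  then show "cadj x ** a = a ** cadj x" by (simp add: cadj_mult)
qed

lemma sum_swap3: "(\<Sum>i\<in>I. \<Sum>p\<in>P. \<Sum>q\<in>R. f i p q) = (\<Sum>p\<in>P. \<Sum>q\<in>R. \<Sum>i\<in>I. f i p q)"
proof -
  have "(\<Sum>i\<in>I. \<Sum>p\<in>P. \<Sum>q\<in>R. f i p q) = (\<Sum>p\<in>P. \<Sum>i\<in>I. \<Sum>q\<in>R. f i p q)"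
    by (rule sum.swap)
  also have "\<dots> = (\<Sum>p\<in>P. \<Sum>q\<in>R. \<Sum>i\<in>I. f i p q)"
    by (rule sum.cong[OF refl]) (rule sum.swap)
  finally show ?thesis .
qed

text \<open>The blocks of the orthogonal projection onto \<open>Y\<close> commute with \<open>D\<close>, so that
  \<open>\<Sum>\<^sub>i \<parallel>v\<^sub>i - Q v\<^sub>i\<parallel>\<^sup>2\<close> is a function of the values of \<open>\<phi>\<close> on \<open>D'\<close> alone and may be computed
  with the Kraus operators \<open>w\<close>, where it vanishes.\<close>

lemma kraus_in_module:
  fixes Y :: "(complex ^ 'h ^ 'k) set"
  assumes Y: "op.subspace Y" and DY: "\<And>d y. d \<in> D \<Longrightarrow> y \<in> Y \<Longrightarrow> d ** y \<in> Y"
    and D: "D\<^sup>\<star> \<subseteq> D"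
    and w: "kraus_operators (commutant D) \<phi> r w" "\<And>i. i < r \<Longrightarrow> w i \<in> Y"
    and v: "kraus_operators (commutant D) \<phi> s v" "i < s"
  shows "v i \<in> Y"
proof -
  obtain Q where QY: "\<And>x. Q x \<in> Y" and Qadd: "\<And>x y. Q (x + y) = Q x + Q y"
    and Qsc: "\<And>c x. Q (op_scale c x) = op_scale c (Q x)" and Qid: "\<And>v. v \<in> Y \<Longrightarrow> Q v = v"
    and Qort: "\<And>u x. u \<in> Y \<Longrightarrow> hs u (x - Q x) = 0"
    using hs_projection[OF Y] by blast
  note Qlin = op_linear_munit[of Q, OF Qadd Qsc]
  \<comment> \<open>Across \<open>hs\<close>, \<open>d\<close> becomes \<open>cadj d\<close>, which
    again preserves \<open>Y\<close>; hence the defect \<open>?z\<close> is an element of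
    \<open>Y\<close> orthogonal to itself.\<close>
  have Qcomm: "Q (d ** x) = d ** Q x" if d: "d \<in> D" for d x
  proof -
    have d': "cadj d \<in> D" using d D by (auto simp: op_set_adj_def)
    let ?z = "Q (d ** x) - d ** Q x"
    have zY: "?z \<in> Y" using Y QY DY[OF d QY] by (simp add: op.subspace_diff)
    have "hs ?z ?z = hs ?z (d ** (x - Q x)) - hs ?z (d ** x - Q (d ** x))"
      by (simp add: hs_diff_right matrix_diff_ldistrib)
    also have "hs ?z (d ** (x - Q x)) = hs (cadj d ** ?z) (x - Q x)"
      by (simp add: hs_mult_left)
    also have "\<dots> = 0" by (rule Qort) (rule DY[OF d' zY])
    also have "hs ?z (d ** x - Q (d ** x)) = 0" by (rule Qort[OF zY])
    finally show ?thesis by simp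
  qed
  \<comment> \<open>\<open>m p q\<close> is the block of \<open>Q\<close> that sends column
    \<open>q\<close> of the argument to its contribution to column \<open>p\<close> of the value.
    Left multiplication acts on all columns alike, so \<open>Qcomm\<close> puts every block into the
    commutant of \<open>D\<close>.\<close>
  define m :: "'h \<Rightarrow> 'h \<Rightarrow> complex ^ 'k ^ 'k"
    where "m p q = (\<chi> a b. Q (munit b q) $ a $ p)" for p q
  have mD: "m p q \<in> commutant D" for p q
  proof (rule commutantI)
    fix d assume d: "d \<in> D"
    have "(m p q ** d) $ a $ b = (d ** m p q) $ a $ b" for a b
    proof -
      have du: "(d ** munit b q) $ t $ q' = (if q' = q then d $ t $ b else 0)" for t q'
        by (auto simp: matrix_matrix_mult_def munit_def if_distrib cong: if_cong)
      have "(m p q ** d) $ a $ b = (\<Sum>t\<in>UNIV. d $ t $ b * Q (munit t q) $ a $ p)"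
        by (simp add: matrix_matrix_mult_def m_def mult.commute)
      also have "\<dots> = Q (d ** munit b q) $ a $ p"
        by (subst Qlin[of "d ** munit b q"]) (simp add: du mult_delta_left)
      also have "\<dots> = (d ** m p q) $ a $ b"
        unfolding Qcomm[OF d] by (simp add: matrix_matrix_mult_def m_def)
      finally show ?thesis .
    qed
    then show "m p q ** d = d ** m p q" by (simp add: vec_eq_iff)
  qed
  have Qm: "Q x $ a $ p = (\<Sum>q\<in>UNIV. \<Sum>t\<in>UNIV. m p q $ a $ t * x $ t $ q)" for x a p
  proof -
    have "Q x $ a $ p = (\<Sum>t\<in>UNIV. \<Sum>q\<in>UNIV. x $ t $ q * Q (munit t q) $ a $ p)"
      by (subst Qlin[of x]) simp
    also have "\<dots> = (\<Sum>q\<in>UNIV. \<Sum>t\<in>UNIV. m p q $ a $ t * x $ t $ q)"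
      by (subst sum.swap) (simp add: m_def mult.commute)
    finally show ?thesis .
  qed
  have hsQ: "hs x (Q x) = (\<Sum>p\<in>UNIV. \<Sum>q\<in>UNIV. (cadj x ** m p q ** x) $ p $ q)" for x
  proof -
    have "hs x (Q x) = (\<Sum>p\<in>UNIV. \<Sum>a\<in>UNIV. cnj (x $ a $ p) * Q x $ a $ p)"
      unfolding hs_def by (rule sum.swap)
    also have "\<dots> = (\<Sum>p\<in>UNIV. \<Sum>a\<in>UNIV. \<Sum>q\<in>UNIV. cnj (x $ a $ p) * (\<Sum>t\<in>UNIV. m p q $ a $ t * x $ t $ q))"
      unfolding Qm by (simp add: sum_distrib_left)
    also have "\<dots> = (\<Sum>p\<in>UNIV. \<Sum>q\<in>UNIV. \<Sum>a\<in>UNIV. cnj (x $ a $ p) * (\<Sum>t\<in>UNIV. m p q $ a $ t * x $ t $ q))"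
      by (rule sum.cong[OF refl]) (rule sum.swap)
    also have "\<dots> = (\<Sum>p\<in>UNIV. \<Sum>q\<in>UNIV. (cadj x ** m p q ** x) $ p $ q)"
      unfolding conj_entry by (simp add: cinner_def matrix_vector_mult_def column_def)
    finally show ?thesis .
  qed
  have dist: "hs x (x - Q x) = of_real ((norm (x - Q x))\<^sup>2)" for x
  proof -
    have "hs (x - Q x) (x - Q x) = hs x (x - Q x) - hs (Q x) (x - Q x)"
      by (simp add: hs_diff_left)
    then show ?thesis using Qort[OF QY] by (simp add: hs_self)
  qed
  \<comment> \<open>The right-hand side does not mention \<open>u\<close>: the blocks lie where the
    Kraus formula holds, so the total squared distance to \<open>Y\<close> is the same for every
    Kraus family of \<open>\<phi>\<close>.\<close>
  have val: "(\<Sum>i<s. of_real ((norm (u i - Q (u i)))\<^sup>2)) =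
      trace (\<phi> (mat 1)) - (\<Sum>p\<in>UNIV. \<Sum>q\<in>UNIV. \<phi> (m p q) $ p $ q)"
    if u: "kraus_operators (commutant D) \<phi> s u" for s u
  proof -
    have ph: "\<phi> b = (\<Sum>i<s. cadj (u i) ** b ** u i)" if "b \<in> commutant D" for b
      using u that by (simp add: kraus_operators_def)
    have "(\<Sum>i<s. of_real ((norm (u i - Q (u i)))\<^sup>2)) = (\<Sum>i<s. hs (u i) (u i)) - (\<Sum>i<s. hs (u i) (Q (u i)))"
      unfolding dist[symmetric] by (simp add: hs_diff_right sum_subtractf)
    also have "(\<Sum>i<s. hs (u i) (u i)) = trace (\<phi> (mat 1))"
      unfolding ph[OF one_commutant] by (simp add: hs_trace trace_def) (rule sum.swap)
    also have "(\<Sum>i<s. hs (u i) (Q (u i))) = (\<Sum>p\<in>UNIV. \<Sum>q\<in>UNIV. \<phi> (m p q) $ p $ q)"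
      unfolding ph[OF mD] hsQ by (simp only: sum_component) (rule sum_swap3)
    finally show ?thesis .
  qed
  have "(\<Sum>i<s. of_real ((norm (v i - Q (v i)))\<^sup>2)) = (\<Sum>i<r. of_real ((norm (w i - Q (w i)))\<^sup>2) :: complex)"
    using val[OF v(1)] val[OF w(1)] by simp
  also have "\<dots> = 0" using w(2) Qid by simp
  finally have "(of_real (\<Sum>i<s. (norm (v i - Q (v i)))\<^sup>2) :: complex) = 0" by simp
  then have "(\<Sum>i<s. (norm (v i - Q (v i)))\<^sup>2) = 0" by (simp only: of_real_eq_0_iff)
  then have "v i = Q (v i)" using v(2) by (simp add: sum_nonneg_eq_0_iff)
  then show ?thesis using QY[of "v i"] by simp
qed

section \<open>Existence of Kraus operators\<close>

lemma cinner_cnj: "cnj (cinner x y) = cinner y x"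
  by (simp add: cinner_def mult.commute)

lemma Re_cinner: "Re (cinner x y) = inner x y"
  by (simp add: cinner_def inner_vec_def inner_complex_def)

lemma cinner_self: "cinner x x = of_real ((norm x)\<^sup>2)"
proof (rule complex_eqI)
  show "Re (cinner x x) = Re (of_real ((norm x)\<^sup>2))"
    by (simp add: Re_cinner power2_norm_eq_inner)
  show "Im (cinner x x) = Im (of_real ((norm x)\<^sup>2))"
    by (simp add: cinner_def mult.commute)
qed

lemma cinner_axis_axis: "cinner (axis p a) (m *v axis q c) = cnj a * m $ p $ q * c"
proof -
  have "(m *v axis q c) $ i = m $ i $ q * c" for i
    by (simp add: matrix_vector_mult_def axis_def if_distrib cong: if_cong)
  then have "cinner (axis p a) (m *v axis q c) = (\<Sum>i\<in>UNIV. if i = p then cnj a * (m $ i $ q * c) else 0)"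
    unfolding cinner_def by (intro sum.cong) (auto simp: axis_def)
  then show ?thesis by simp
qed

lemma matrix_vector_bound:
  fixes x :: "complex ^ 'n ^ 'm"
  obtains t where "t > 0" "\<And>\<xi>. norm (x *v \<xi>) \<le> t * norm \<xi>"
proof -
  have "linear ((*v) x)"
    by (rule linearI) (simp_all add: algebra_simps vec_eq_iff matrix_vector_mult_def
        sum.distrib scaleR_sum_right)
  then have "bounded_linear ((*v) x)" by (rule linear_conv_bounded_linear[THEN iffD1])
  from bounded_linear.pos_bounded[OF this] show thesis
    using that by (auto simp: mult.commute)
qed

lemma linear_map_on_sum:
  assumes "op.subspace B" "linear_map_on B \<psi>" "\<And>i. i \<in> I \<Longrightarrow> f i \<in> B"
  shows "\<psi> (sum f I) = (\<Sum>i\<in>I. \<psi> (f i))"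
proof -
  have z: "\<psi> 0 = 0"
    using assms(2) op.subspace_0[OF assms(1)] unfolding linear_map_on_def
    by (metis add_cancel_right_left add_0)
  show ?thesis
    using assms(3)
  proof (induction I rule: infinite_finite_induct)
    case (insert i I)
    then show ?case
      using assms(2) op.subspace_sum[OF assms(1), of I f] by (simp add: linear_map_on_def)
  qed (use z in auto)
qed

text \<open>Positivity of the block matrix \<open>[t, x; x*, t]\<close> for large \<open>t\<close> forces the off-diagonal
  entries of its image to be adjoint to each other.\<close>

lemma cp_unital_adj:
  assumes B: "op.subspace B" "B\<^sup>\<star> \<subseteq> B" "mat 1 \<in> B"
    and cp: "completely_positive B \<phi>" and unital: "\<phi> (mat 1) = mat 1" and x: "x \<in> B"
  shows "\<phi> (cadj x) = cadj (\<phi> x)"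
proof -
  obtain t where t: "t > 0" "\<And>\<xi>. norm (x *v \<xi>) \<le> t * norm \<xi>"
    using matrix_vector_bound[of x] by blast
  \<comment> \<open>Only the indices 0 and 1 are used. Cauchy-Schwarz and the bound of 2ab by a^2 +
    b^2 let the diagonal \<open>t\<close> dominate the off-diagonal \<open>x\<close>.\<close>
  define X where "X i j = (if i = j then op_scale (of_real t) (mat 1)
      else if i = (0::nat) then x else cadj x)" for i j :: nat
  have XB: "X i j \<in> B" for i j
    using B x by (auto simp: X_def op_set_adj_def op.subspace_scale)
  have tc: "cinner \<xi> (op_scale (of_real t) (mat 1) *v \<eta>) = t * cinner \<xi> \<eta>" for \<xi> \<eta> :: "complex ^ 'z"
  proof -
    have "op_scale (of_real t) (mat 1) *v \<eta> = (\<chi> i. t * \<eta> $ i)"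
      by (simp add: vec_eq_iff matrix_vector_mult_def mat_def mult_delta_left mult_delta_right)
    then show ?thesis by (simp add: cinner_def sum_distrib_left mult_ac)
  qed
  have "block_positive 2 X"
    unfolding block_positive_def
  proof
    fix \<xi> :: "nat \<Rightarrow> complex ^ 'a"
    have "(\<Sum>i<2. \<Sum>j<2. cinner (\<xi> i) (X i j *v \<xi> j)) =
      t * cinner (\<xi> 0) (\<xi> 0) + t * cinner (\<xi> 1) (\<xi> 1) +
      (cinner (\<xi> 0) (x *v \<xi> 1) + cnj (cinner (\<xi> 0) (x *v \<xi> 1)))"
      by (simp add: numeral_2_eq_2 X_def tc cinner_cnj cinner_adj[of _ "cadj x"])
    also have "\<dots> = of_real (t * (norm (\<xi> 0))\<^sup>2 + t * (norm (\<xi> 1))\<^sup>2 + 2 * inner (\<xi> 0) (x *v \<xi> 1))"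
      by (simp add: cinner_self complex_add_cnj Re_cinner)
    also have "\<dots> \<in> \<real>\<^sub>\<ge>\<^sub>0"
    proof -
      have "\<bar>inner (\<xi> 0) (x *v \<xi> 1)\<bar> \<le> norm (\<xi> 0) * norm (x *v \<xi> 1)"
        by (rule Cauchy_Schwarz_ineq2)
      also have "\<dots> \<le> norm (\<xi> 0) * (t * norm (\<xi> 1))"
        by (intro mult_left_mono t) auto
      finally have 1: "2 * \<bar>inner (\<xi> 0) (x *v \<xi> 1)\<bar> \<le> t * (2 * norm (\<xi> 0) * norm (\<xi> 1))"
        by (simp add: mult_ac)
      have "2 * norm (\<xi> 0) * norm (\<xi> 1) \<le> (norm (\<xi> 0))\<^sup>2 + (norm (\<xi> 1))\<^sup>2"
        by (rule sum_squares_bound)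
      then have "t * (2 * norm (\<xi> 0) * norm (\<xi> 1)) \<le> t * ((norm (\<xi> 0))\<^sup>2 + (norm (\<xi> 1))\<^sup>2)"
        using t(1) by (intro mult_left_mono) auto
      with 1 show ?thesis by (simp add: distrib_left del: of_real_add of_real_mult)
    qed
    finally show "(\<Sum>i<2. \<Sum>j<2. cinner (\<xi> i) (X i j *v \<xi> j)) \<in> \<real>\<^sub>\<ge>\<^sub>0" .
  qed
  then have pos: "block_positive 2 (\<lambda>i j. \<phi> (X i j))"
    using cp XB by (simp add: completely_positive_def)
  have lin: "\<phi> (op_scale c (mat 1)) = op_scale c (mat 1)" for c
    using cp B unital by (simp add: completely_positive_def linear_map_on_def)
  \<comment> \<open>The test vectors \<open>axis p 1\<close> and \<open>axis q c\<close> isolate one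
    off-diagonal pair; the diagonal contributes only real numbers.\<close>
  have Im: "Im (\<phi> x $ p $ q * c + cnj c * \<phi> (cadj x) $ q $ p) = 0" for p q c
  proof -
    define \<xi> :: "nat \<Rightarrow> complex ^ 'b" where "\<xi> i = (if i = 0 then axis p 1 else axis q c)" for i
    have "(\<Sum>i<2. \<Sum>j<2. cinner (\<xi> i) (\<phi> (X i j) *v \<xi> j)) =
      t * cinner (axis p 1) (axis p 1 :: complex ^ 'b) + t * cinner (axis q c) (axis q c :: complex ^ 'b) +
       (\<phi> x $ p $ q * c + cnj c * \<phi> (cadj x) $ q $ p)"
      by (simp add: numeral_2_eq_2 X_def \<xi>_def cinner_axis_axis lin tc)
    moreover have "Im (\<Sum>i<2. \<Sum>j<2. cinner (\<xi> i) (\<phi> (X i j) *v \<xi> j)) = 0"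
      using pos by (simp add: block_positive_def complex_nonneg_Reals_iff)
    ultimately show ?thesis by (simp add: cinner_self)
  qed
  show ?thesis
    unfolding vec_eq_iff
  proof (intro allI)
    fix q p
    \<comment> \<open>\<open>c = 1\<close> compares the imaginary parts and \<open>c = \<i>\<close>
      the real parts.\<close>
    show "\<phi> (cadj x) $ q $ p = cadj (\<phi> x) $ q $ p"
      using Im[of p q 1] Im[of p q \<i>] by (simp add: complex_eq_iff)
  qed
qed

text \<open>\<open>B\<close> need not contain the matrix units, so a map on \<open>B\<close> is
  encoded by its values at their projections \<open>E (munit p q)\<close>, which span
  \<open>B\<close>. This moves the separation argument into a finite-dimensional real space.\<close>

lemma cp_unital_kraus_exists:
  fixes B :: "(complex ^ 'k ^ 'k) set" and \<phi> :: "complex ^ 'k ^ 'k \<Rightarrow> complex ^ 'h ^ 'h"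
  assumes B: "op.subspace B" "B\<^sup>\<star> \<subseteq> B" "mat 1 \<in> B"
    and cp: "completely_positive B \<phi>" and unital: "\<phi> (mat 1) = mat 1"
  shows "\<exists>r v. kraus_operators B \<phi> r v"
proof -
  obtain E where EB: "\<And>x. E x \<in> B" and Eadd: "\<And>x y. E (x + y) = E x + E y"
    and Esc: "\<And>c x. E (op_scale c x) = op_scale c (E x)" and Eid: "\<And>v. v \<in> B \<Longrightarrow> E v = v"
    using hs_projection[OF B(1)] by metis
  have lin: "linear_map_on B \<phi>" using cp by (simp add: completely_positive_def)
  have linv: "linear_map_on B (\<lambda>b. cadj v ** b ** v)" for v :: "complex ^ 'h ^ 'k"
    by (simp add: linear_map_on_def matrix_add_ldistrib matrix_add_rdistrib
        op_scale_mult_left op_scale_mult_right)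
  define vec :: "(complex ^ 'k ^ 'k \<Rightarrow> complex ^ 'h ^ 'h) \<Rightarrow> complex ^ 'h ^ 'h ^ 'k ^ 'k"
    where "vec \<psi> = (\<chi> p q. \<psi> (E (munit p q)))" for \<psi>
  have val: "\<psi> b = (\<Sum>p\<in>UNIV. \<Sum>q\<in>UNIV. op_scale (b $ p $ q) (vec \<psi> $ p $ q))"
    if "linear_map_on B \<psi>" "b \<in> B" for \<psi> b
  proof -
    have "\<psi> (E b) = (\<Sum>p\<in>UNIV. \<Sum>q\<in>UNIV. op_scale (b $ p $ q) (\<psi> (E (munit p q))))"
      by (rule op_linear_munit) (use that EB in \<open>auto simp: linear_map_on_def Eadd Esc\<close>)
    then show ?thesis using Eid[OF that(2)] by (simp add: vec_def)
  qed
  define F where "F v = vec (\<lambda>b. cadj v ** b ** v)" for v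
  \<comment> \<open>The trace of \<open>\<phi> (mat 1)\<close> is \<open>h\<close>, whereas the
    trace of \<open>cadj v ** v\<close> is 1 for a unit \<open>v\<close>; hence the factor
    \<open>1 / h\<close> below.\<close>
  define h where "h = real CARD('h)"
  have h: "h > 0" by (simp add: h_def)
  define K where "K = convex hull (F ` sphere 0 1)"
  have "continuous_on (sphere 0 1) F"
    unfolding F_def vec_def matrix_matrix_mult_def cadj_def
    by (intro continuous_intros)
  then have K: "compact K"
    unfolding K_def by (intro compact_convex_hull compact_continuous_image compact_sphere)
  have "(1 / h) *\<^sub>R vec \<phi> \<in> K"
  proof (rule ccontr)
    assume "(1 / h) *\<^sub>R vec \<phi> \<notin> K"
    then obtain a \<beta> where a: "inner a ((1 / h) *\<^sub>R vec \<phi>) < \<beta>" "\<And>x. x \<in> K \<Longrightarrow> inner a x > \<beta>"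
      using separating_hyperplane_closed_point[of K] K
      by (metis K_def compact_imp_closed convex_convex_hull)
    \<comment> \<open>The blocks turn \<open>inner a\<close> into a functional of the values of a
      map on \<open>B\<close>; the conjugates come from the first argument of \<open>hs\<close>. The
      diagonal term subtracts \<open>\<beta>\<close> times the trace at the identity, so that
      separation by \<open>\<beta>\<close> becomes a question of sign.\<close>
    define y where "y i j = (\<Sum>p\<in>UNIV. \<Sum>q\<in>UNIV. op_scale (cnj (a $ p $ q $ i $ j)) (E (munit p q)))
      + (if i = j then op_scale (- of_real \<beta>) (mat 1) else 0)" for i j
    have y0B: "(\<Sum>p\<in>P. \<Sum>q\<in>R. op_scale (c p q) (E (munit p q))) \<in> B" for P R c
      by (intro op.subspace_sum[OF B(1)] op.subspace_scale[OF B(1)] EB)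
    have yB: "y i j \<in> B" for i j
      unfolding y_def using y0B B
      by (intro op.subspace_add) (auto simp: op.subspace_scale op.subspace_0 op.subspace_neg)
    define W where "W \<psi> = (\<Sum>i\<in>UNIV. \<Sum>j\<in>UNIV. \<psi> (y i j) $ i $ j)"
      for \<psi> :: "complex ^ 'k ^ 'k \<Rightarrow> complex ^ 'h ^ 'h"
    have W: "Re (W \<psi>) = inner a (vec \<psi>) - \<beta> * Re (trace (\<psi> (mat 1)))"
      if "linear_map_on B \<psi>" for \<psi>
    proof -
      have sc: "\<psi> (op_scale c b) = op_scale c (\<psi> b)" if "b \<in> B" for c b
        using \<open>linear_map_on B \<psi>\<close> that by (simp add: linear_map_on_def)
      have ad: "\<psi> (b + c) = \<psi> b + \<psi> c" if "b \<in> B" "c \<in> B" for c b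
        using \<open>linear_map_on B \<psi>\<close> that by (simp add: linear_map_on_def)
      have z: "\<psi> 0 = 0" using linear_map_on_sum[OF B(1) that, of "{}"] by simp
      have "\<psi> (\<Sum>p\<in>UNIV. \<Sum>q\<in>UNIV. op_scale (c p q) (E (munit p q))) =
          (\<Sum>p\<in>UNIV. \<Sum>q\<in>UNIV. op_scale (c p q) (vec \<psi> $ p $ q))" for c
      proof -
        have "\<psi> (\<Sum>p\<in>UNIV. \<Sum>q\<in>UNIV. op_scale (c p q) (E (munit p q))) =
          (\<Sum>p\<in>UNIV. \<psi> (\<Sum>q\<in>UNIV. op_scale (c p q) (E (munit p q))))"
          by (rule linear_map_on_sum[OF B(1) that])
             (intro op.subspace_sum[OF B(1)] op.subspace_scale[OF B(1)] EB)
        also have "\<dots> = (\<Sum>p\<in>UNIV. \<Sum>q\<in>UNIV. \<psi> (op_scale (c p q) (E (munit p q))))"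
          by (intro sum.cong refl linear_map_on_sum[OF B(1) that] op.subspace_scale[OF B(1)] EB)
        finally show ?thesis by (simp add: sc EB vec_def)
      qed
      then have "\<psi> (y i j) = (\<Sum>p\<in>UNIV. \<Sum>q\<in>UNIV. op_scale (cnj (a $ p $ q $ i $ j)) (vec \<psi> $ p $ q))
         + (if i = j then op_scale (- of_real \<beta>) (\<psi> (mat 1)) else 0)" for i j
        unfolding y_def using B y0B
        by (subst ad) (auto simp: sc z op.subspace_scale op.subspace_0 simp del: op.scale_minus_left)
      then have "\<psi> (y i j) $ i $ j = (\<Sum>p\<in>UNIV. \<Sum>q\<in>UNIV. cnj (a $ p $ q $ i $ j) * vec \<psi> $ p $ q $ i $ j)
         + (if i = j then - of_real \<beta> * \<psi> (mat 1) $ i $ j else 0)" for i j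
        by simp
      then have "W \<psi> = (\<Sum>i\<in>UNIV. \<Sum>j\<in>UNIV. \<Sum>p\<in>UNIV. \<Sum>q\<in>UNIV. cnj (a $ p $ q $ i $ j) * vec \<psi> $ p $ q $ i $ j)
         + (\<Sum>i\<in>UNIV. \<Sum>j\<in>UNIV. if i = j then - of_real \<beta> * \<psi> (mat 1) $ i $ j else 0)"
        unfolding W_def by (simp only: sum.distrib)
      also have "(\<Sum>i\<in>UNIV. \<Sum>j\<in>UNIV. if i = j then - of_real \<beta> * \<psi> (mat 1) $ i $ j else 0)
         = - of_real \<beta> * trace (\<psi> (mat 1))"
        by (simp add: trace_def sum_distrib_left sum_negf)
      also have "(\<Sum>i\<in>UNIV. \<Sum>j\<in>UNIV. \<Sum>p\<in>UNIV. \<Sum>q\<in>UNIV. cnj (a $ p $ q $ i $ j) * vec \<psi> $ p $ q $ i $ j)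
         = (\<Sum>p\<in>UNIV. \<Sum>q\<in>UNIV. hs (a $ p $ q) (vec \<psi> $ p $ q))"
        unfolding hs_def
        by (simp only: sum_swap3[where I="UNIV :: 'h set" and P="UNIV :: 'k set" and R="UNIV :: 'k set"])
      finally show ?thesis
        by (simp add: inner_vec_def[of a] inner_vec_def[of "a $ _"] inner_eq_Re_hs)
    qed
    have Fsc: "F (r *\<^sub>R v) = (r * r) *\<^sub>R F v" for r v
      by (simp add: F_def vec_def vec_eq_iff scaleR_eq_op_scale cadj_scale
          op_scale_mult_left op_scale_mult_right mult_ac)
    \<comment> \<open>\<open>F\<close> is quadratic in \<open>v\<close>, so the bound on the unit
      sphere extends to every \<open>v\<close>.\<close>
    have pos: "0 \<le> Re (W (\<lambda>b. cadj v ** b ** v))" for v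
    proof (cases "v = 0")
      case True
      then show ?thesis by (simp add: W_def)
    next
      case False
      let ?u = "(1 / norm v) *\<^sub>R v"
      have "F ?u \<in> K" unfolding K_def by (rule hull_inc) (use False in auto)
      then have "inner a (F ?u) > \<beta>" by (rule a)
      moreover have "F v = (norm v)\<^sup>2 *\<^sub>R F ?u"
        using False by (simp add: Fsc power2_eq_square)
      moreover have "Re (trace (cadj v ** mat 1 ** v)) = (norm v)\<^sup>2"
        using hs_self[of v] by (simp add: hs_trace)
      ultimately show ?thesis
        unfolding W[OF linv] F_def[symmetric] using False
        by (simp add: mult.commute[of \<beta>] mult_left_mono less_imp_le flip: right_diff_distrib)
    qed
    have neg: "Re (W \<phi>) < 0"
    proof -
      have "Re (trace (\<phi> (mat 1))) = h"
        unfolding unital by (simp add: trace_def mat_def h_def)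
      then show ?thesis using a(1) h by (simp add: W[OF lin] field_simps)
    qed
    \<comment> \<open>\<open>block_positive\<close> demands real values, not just nonnegative real
      parts, so \<open>y\<close> is replaced by its hermitian part. In return \<open>\<phi>\<close>
      has to preserve adjoints.\<close>
    define z where "z i j = op_scale (1/2) (y i j + cadj (y j i))" for i j
    have yB': "cadj (y i j) \<in> B" for i j
      using yB[of i j] B(2) by (auto simp: op_set_adj_def)
    have zB: "z i j \<in> B" for i j
      unfolding z_def using B(1) yB yB' by (intro op.subspace_scale op.subspace_add)
    have sumz: "(\<Sum>i\<in>UNIV. \<Sum>j\<in>UNIV. \<psi> (z i j) $ i $ j) = of_real (Re (W \<psi>))"
      if l: "linear_map_on B \<psi>" and adj: "\<And>b. b \<in> B \<Longrightarrow> \<psi> (cadj b) = cadj (\<psi> b)" for \<psi>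
    proof -
      have "\<psi> (z i j) $ i $ j = (\<psi> (y i j) $ i $ j + cnj (\<psi> (y j i) $ j $ i)) / 2" for i j
        using l yB yB' op.subspace_add[OF B(1) yB yB']
        by (simp add: z_def linear_map_on_def adj)
      then have "(\<Sum>i\<in>UNIV. \<Sum>j\<in>UNIV. \<psi> (z i j) $ i $ j) =
        (W \<psi> + (\<Sum>i\<in>UNIV. \<Sum>j\<in>UNIV. cnj (\<psi> (y j i) $ j $ i))) / 2"
        by (simp only: W_def sum.distrib flip: sum_divide_distrib)
      also have "(\<Sum>i\<in>UNIV. \<Sum>j\<in>UNIV. cnj (\<psi> (y j i) $ j $ i)) = cnj (W \<psi>)"
        by (simp add: W_def) (rule sum.swap)
      finally show ?thesis by (simp add: complex_add_cnj)
    qed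
    \<comment> \<open>Block matrices are indexed by natural numbers, so \<open>e\<close> enumerates
      the coordinates of the space.\<close>
    define n where "n = CARD('h)"
    obtain e :: "nat \<Rightarrow> 'h" where e: "bij_betw e {..<n} UNIV"
      using ex_bij_betw_nat_finite[of "UNIV :: 'h set"] by (auto simp: n_def atLeast0LessThan)
    define e' where "e' = inv_into {..<n} e"
    have e': "e' (e i) = i" if "i < n" for i
      using e that by (simp add: e'_def bij_betw_def)
    have re: "(\<Sum>i<n. \<Sum>j<n. f (e i) (e j)) = (\<Sum>i\<in>UNIV. \<Sum>j\<in>UNIV. f i j)" for f :: "'h \<Rightarrow> 'h \<Rightarrow> complex"
      using sum.reindex_bij_betw[OF e] by (simp add: sum.reindex_bij_betw[OF e, symmetric])
    have "block_positive n (\<lambda>i j. z (e i) (e j))"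
      unfolding block_positive_def
    proof
      fix \<xi> :: "nat \<Rightarrow> complex ^ 'k"
      \<comment> \<open>With the test vectors as its columns, \<open>v\<close> turns the quadratic
        form of \<open>z\<close> into the functional at \<open>b \<mapsto> cadj v ** b ** v\<close>,
        which \<open>pos\<close> controls.\<close>
      define v :: "complex ^ 'h ^ 'k" where "v = (\<chi> r i. \<xi> (e' i) $ r)"
      have col: "column (e i) v = \<xi> i" if "i < n" for i
        using that by (simp add: column_def v_def e' vec_eq_iff)
      have "(\<Sum>i<n. \<Sum>j<n. cinner (\<xi> i) (z (e i) (e j) *v \<xi> j)) =
        (\<Sum>i<n. \<Sum>j<n. (cadj v ** z (e i) (e j) ** v) $ e i $ e j)"
        by (intro sum.cong refl) (simp add: conj_entry col)
      also have "\<dots> = of_real (Re (W (\<lambda>b. cadj v ** b ** v)))"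
        unfolding re[of "\<lambda>p q. (cadj v ** z p q ** v) $ p $ q"] by (rule sumz[OF linv]) (simp add: cadj_mult matrix_mul_assoc)
      finally show "(\<Sum>i<n. \<Sum>j<n. cinner (\<xi> i) (z (e i) (e j) *v \<xi> j)) \<in> \<real>\<^sub>\<ge>\<^sub>0"
        using pos by simp
    qed
    then have "block_positive n (\<lambda>i j. \<phi> (z (e i) (e j)))"
      using cp zB by (simp add: completely_positive_def)
    \<comment> \<open>Evaluation at the standard basis vectors gives the functional at
      \<open>\<phi>\<close> itself, which contradicts \<open>neg\<close>.\<close>
    then have "(\<Sum>i<n. \<Sum>j<n. cinner (axis (e i) 1) (\<phi> (z (e i) (e j)) *v axis (e j) 1)) \<in> \<real>\<^sub>\<ge>\<^sub>0"
      unfolding block_positive_def by (rule spec[of _ "\<lambda>i. axis (e i) 1"])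
    then have "(\<Sum>i\<in>UNIV. \<Sum>j\<in>UNIV. \<phi> (z i j) $ i $ j) \<in> \<real>\<^sub>\<ge>\<^sub>0"
      by (simp add: cinner_axis_axis re[of "\<lambda>p q. \<phi> (z p q) $ p $ q"])
    then have "Re (W \<phi>) \<ge> 0"
      using sumz[OF lin cp_unital_adj[OF B cp unital]] by simp
    then show False using neg by simp
  qed
  then obtain k u x where u: "\<forall>i\<in>{1::nat..k}. 0 \<le> u i \<and> x i \<in> F ` sphere 0 1"
    and sum: "(\<Sum>i=1..k. u i *\<^sub>R x i) = (1 / h) *\<^sub>R vec \<phi>"
    unfolding K_def convex_hull_indexed by blast
  then obtain v where v: "\<And>i. i \<in> {1..k} \<Longrightarrow> x i = F (v i)"
    unfolding image_iff by metis
  have vec: "vec \<phi> = (\<Sum>i=1..k. (h * u i) *\<^sub>R F (v i))"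
  proof -
    have "vec \<phi> = h *\<^sub>R ((1 / h) *\<^sub>R vec \<phi>)" using h by simp
    also have "\<dots> = (\<Sum>i=1..k. (h * u i) *\<^sub>R x i)"
      unfolding sum[symmetric] by (simp add: scaleR_sum_right)
    also have "\<dots> = (\<Sum>i=1..k. (h * u i) *\<^sub>R F (v i))"
      by (rule sum.cong) (simp_all add: v)
    finally show ?thesis .
  qed
  \<comment> \<open>The weights and the factor \<open>h\<close> are absorbed as square roots; the
    shift turns indices from 1 to \<open>k\<close> into indices below \<open>k\<close>.\<close>
  define w where "w i = sqrt (h * u (Suc i)) *\<^sub>R v (Suc i)" for i
  have "kraus_operators B \<phi> k w"
    unfolding kraus_operators_def
  proof
    fix b assume b: "b \<in> B"
    have "\<phi> b = (\<Sum>p\<in>UNIV. \<Sum>q\<in>UNIV. \<Sum>i=1..k. op_scale (b $ p $ q) ((h * u i) *\<^sub>R F (v i) $ p $ q))"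
      unfolding val[OF lin b] vec by (simp add: op.scale_sum_right)
    also have "\<dots> = (\<Sum>i=1..k. \<Sum>p\<in>UNIV. \<Sum>q\<in>UNIV. op_scale (b $ p $ q) ((h * u i) *\<^sub>R F (v i) $ p $ q))"
      by (rule sum_swap3[symmetric])
    also have "\<dots> = (\<Sum>i=1..k. (h * u i) *\<^sub>R (cadj (v i) ** b ** v i))"
      unfolding val[OF linv b] F_def[symmetric]
      by (simp add: scaleR_eq_op_scale op.scale_sum_right mult_ac)
    also have "\<dots> = (\<Sum>i<k. (h * u (Suc i)) *\<^sub>R (cadj (v (Suc i)) ** b ** v (Suc i)))"
      by (simp add: sum.atLeast1_atMost_eq)
    also have "\<dots> = (\<Sum>i<k. cadj (w i) ** b ** w i)"
    proof (rule sum.cong[OF refl])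
      fix i assume "i \<in> {..<k}"
      then have nn: "0 \<le> h * u (Suc i)" using u h by auto
      then have "op_scale (of_real (h * u (Suc i))) c =
          op_scale (of_real (sqrt (h * u (Suc i)))) (op_scale (of_real (sqrt (h * u (Suc i)))) c)"
        for c :: "complex ^ 'h ^ 'h"
        unfolding op.scale_scale of_real_mult[symmetric] by simp
      then show "(h * u (Suc i)) *\<^sub>R (cadj (v (Suc i)) ** b ** v (Suc i)) = cadj (w i) ** b ** w i"
        unfolding w_def scaleR_eq_op_scale cadj_scale op_scale_mult_left op_scale_mult_right
        by simp
    qed
    finally show "\<phi> b = (\<Sum>i<k. cadj (w i) ** b ** w i)" .
  qed
  then show ?thesis by blast
qed

section \<open>From a faithful map to a TRO\<close>

lemma op_subspace_vimage:
  assumes "op.subspace V"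
  shows "op.subspace {x. d ** x ** e \<in> V}" and "op.subspace {x. d ** cadj x ** e \<in> V}"
  using assms unfolding op.subspace_def
  by (auto simp: matrix_add_ldistrib matrix_add_rdistrib op_scale_mult_left op_scale_mult_right
      cadj_add cadj_scale)

lemma op_span_mult:
  assumes "op.subspace V" "\<And>g. g \<in> G \<Longrightarrow> d ** g ** e \<in> V" "x \<in> op.span G"
  shows "d ** x ** e \<in> V"
  using op.span_minimal[OF _ op_subspace_vimage(1)[OF assms(1)], of G d e] assms(2,3) by blast

lemma op_span_mult_adj:
  assumes "op.subspace V" "\<And>g. g \<in> G \<Longrightarrow> d ** cadj g ** e \<in> V" "x \<in> op.span G"
  shows "d ** cadj x ** e \<in> V"
  using op.span_minimal[OF _ op_subspace_vimage(2)[OF assms(1)], of G d e] assms(2,3) by blast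

text \<open>The two variables are extended one after the other; conjugate linearity in the first is
  harmless because \<open>V\<close> is a complex subspace.\<close>

lemma op_span_sandwich:
  assumes V: "op.subspace V" and g: "\<And>g g'. g \<in> G \<Longrightarrow> g' \<in> G' \<Longrightarrow> cadj g ** t ** g' \<in> V"
    and x: "x \<in> op.span G" and y: "y \<in> op.span G'"
  shows "cadj x ** t ** y \<in> V"
proof -
  have "mat 1 ** cadj x ** (t ** g') \<in> V" if "g' \<in> G'" for g'
    by (rule op_span_mult_adj[OF V _ x]) (use g that in \<open>simp add: matrix_mul_assoc\<close>)
  then have "(cadj x ** t) ** y ** mat 1 \<in> V"
    by (intro op_span_mult[OF V _ y]) (simp add: matrix_mul_assoc)
  then show ?thesis by simp
qed

lemma op_span_sandwich_adj:
  assumes V: "op.subspace V" and g: "\<And>g g'. g \<in> G \<Longrightarrow> g' \<in> G' \<Longrightarrow> g ** t ** cadj g' \<in> V"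
    and x: "x \<in> op.span G" and y: "y \<in> op.span G'"
  shows "x ** t ** cadj y \<in> V"
proof -
  have "mat 1 ** x ** (t ** cadj g') \<in> V" if "g' \<in> G'" for g'
    by (rule op_span_mult[OF V _ x]) (use g that in \<open>simp add: matrix_mul_assoc\<close>)
  then have "(x ** t) ** cadj y ** mat 1 \<in> V"
    by (intro op_span_mult_adj[OF V _ y]) (simp add: matrix_mul_assoc)
  then show ?thesis by simp
qed

lemma star_subset_iff: "X\<^sup>\<star> \<subseteq> X \<longleftrightarrow> (\<forall>x\<in>X. cadj x \<in> X)"
  by (auto simp: op_set_adj_def)

lemma mult_adj_subset_iff:
  "X\<^sup>\<star> \<odot> T \<odot> Y \<subseteq> S \<longleftrightarrow> (\<forall>x\<in>X. \<forall>t\<in>T. \<forall>y\<in>Y. cadj x ** t ** y \<in> S)"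
  "X \<odot> S' \<odot> Y\<^sup>\<star> \<subseteq> T' \<longleftrightarrow> (\<forall>x\<in>X. \<forall>s\<in>S'. \<forall>y\<in>Y. x ** s ** cadj y \<in> T')"
  "X \<odot> Z\<^sup>\<star> \<odot> Y \<subseteq> W \<longleftrightarrow> (\<forall>x\<in>X. \<forall>z\<in>Z. \<forall>y\<in>Y. x ** cadj z ** y \<in> W)"
  "C \<odot> X \<odot> D \<subseteq> W \<longleftrightarrow> (\<forall>c\<in>C. \<forall>x\<in>X. \<forall>d\<in>D. c ** x ** d \<in> W)"
  unfolding op_set_mult_def op_set_adj_def by blast+

lemma mult_subset_iff: "X \<odot> Y \<subseteq> Z \<longleftrightarrow> (\<forall>x\<in>X. \<forall>y\<in>Y. x ** y \<in> Z)"
  unfolding op_set_mult_def by blast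

lemma kraus_in_span: "v i \<in> op.span {b ** v i ** a | b i a. b \<in> commutant B \<and> i < (r::nat) \<and> a \<in> commutant A}"
  if "i < r"
  by (rule op.span_base) (use that one_commutant matrix_mul_lid matrix_mul_rid in \<open>metis (mono_tags, lifting) mem_Collect_eq\<close>)

text \<open>The choice only guarantees some Kraus family, so later arguments have to cope with an
  arbitrary one.\<close>

lemma kraus_space_eq:
  assumes "\<exists>r v. kraus_operators B \<phi> r v"
  obtains r v where "kraus_operators B \<phi> r v"
    "kraus_space B A \<phi> = op.span {b ** v i ** a | b i a. b \<in> commutant B \<and> i < r \<and> a \<in> commutant A}"
proof -
  have "\<exists>X. \<exists>r v. kraus_operators B \<phi> r v \<and>
      X = op.span {b ** v i ** a | b i a. b \<in> commutant B \<and> i < r \<and> a \<in> commutant A}"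
    using assms by blast
  then have "\<exists>r v. kraus_operators B \<phi> r v \<and>
      kraus_space B A \<phi> = op.span {b ** v i ** a | b i a. b \<in> commutant B \<and> i < r \<and> a \<in> commutant A}"
    unfolding kraus_space_def by (rule someI_ex)
  then show thesis using that by blast
qed

text \<open>The unit is the Hilbert-Schmidt projection of \<open>1\<close> onto \<open>D\<close>.\<close>

lemma star_algebra_unit:
  fixes D :: "(complex ^ 'n ^ 'n) set"
  assumes D: "op.subspace D" "\<And>x y. x \<in> D \<Longrightarrow> y \<in> D \<Longrightarrow> x ** y \<in> D" "D\<^sup>\<star> \<subseteq> D"
  obtains p where "p \<in> D" "\<And>d. d \<in> D \<Longrightarrow> p ** d = d"
proof -
  obtain Q where QD: "\<And>x. Q x \<in> D" and ort: "\<And>u x. u \<in> D \<Longrightarrow> hs u (x - Q x) = 0"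
    using hs_projection[OF D(1)] by metis
  let ?p = "Q (mat 1)"
  show thesis
  proof (rule that[OF QD])
    fix d assume d: "d \<in> D"
    let ?z = "d - ?p ** d"
    have zD: "?z \<in> D" using D(1,2) QD d by (simp add: op.subspace_diff)
    \<comment> \<open>\<open>?z ** cadj d\<close> lies in \<open>D\<close>, and
      \<open>mat 1 - ?p\<close> is orthogonal to \<open>D\<close>.\<close>
    have "hs ?z ?z = hs ?z ((mat 1 - ?p) ** cadj (cadj d))"
      by (simp add: matrix_diff_rdistrib)
    also have "\<dots> = hs (?z ** cadj d) (mat 1 - ?p)"
      by (rule hs_mult_right[symmetric])
    also have "\<dots> = 0"
      using zD d D(2,3) by (intro ort) (auto simp: star_subset_iff)
    finally show "?p ** d = d" by simp
  qed
qed

text \<open>\<open>b\<close> equals \<open>b ** mat 1\<close>, and the identity is a combination of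
  products from \<open>X\<close> and \<open>Y\<close>. With \<open>V = {0}\<close> this shows that
  \<open>b\<close> vanishes once it kills these products.\<close>

lemma mult_unit_mem_span:
  assumes "mat 1 \<in> op.span (X \<odot> Y)" "op.subspace V" "\<And>x y. x \<in> X \<Longrightarrow> y \<in> Y \<Longrightarrow> b ** x ** y \<in> V"
  shows "b \<in> V"
proof -
  have "b ** mat 1 ** mat 1 \<in> V"
    by (rule op_span_mult[OF assms(2) _ assms(1)])
      (use assms(3) in \<open>auto simp: op_set_mult_def matrix_mul_assoc\<close>)
  then show ?thesis by simp
qed

text \<open>Besides the four inclusions, three features of a Kraus space enter: it is a bimodule,
  the products \<open>cadj (v i) ** v i\<close> sum to the identity, and the \<open>v i\<close>
  detect the elements of \<open>B\<close>.\<close>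

lemma TRO_of_bimodule:
  fixes S A :: "(complex ^ 'h ^ 'h) set" and T B :: "(complex ^ 'k ^ 'k) set"
    and X :: "(complex ^ 'h ^ 'k) set"
  assumes SA: "quantum_graph S A" and TB: "quantum_graph T B"
    and X: "\<And>b x a. b \<in> commutant B \<Longrightarrow> x \<in> X \<Longrightarrow> a \<in> commutant A \<Longrightarrow> b ** x ** a \<in> X"
    and v: "\<And>i. i < (r::nat) \<Longrightarrow> v i \<in> X" "(\<Sum>i<r. cadj (v i) ** v i) = mat 1"
    and faith: "\<And>b. b \<in> B \<Longrightarrow> (\<And>i. i < r \<Longrightarrow> b ** v i = 0) \<Longrightarrow> b = 0"
    and XTX: "X\<^sup>\<star> \<odot> T \<odot> X \<subseteq> S" and XSX: "X \<odot> S \<odot> X\<^sup>\<star> \<subseteq> T"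
    and XBX: "X\<^sup>\<star> \<odot> B \<odot> X \<subseteq> A" and XAX: "X \<odot> A \<odot> X\<^sup>\<star> \<subseteq> B"
  shows "\<exists>M. TRO M \<and> nondegenerate M \<and> bimodule (commutant B) (commutant A) M \<and>
        M\<^sup>\<star> \<odot> T \<odot> M \<subseteq> S \<and> M \<odot> S \<odot> M\<^sup>\<star> \<subseteq> T \<and>
        M\<^sup>\<star> \<odot> B \<odot> M \<subseteq> A \<and> M \<odot> A \<odot> M\<^sup>\<star> \<subseteq> B"
proof -
  have S: "op.subspace S" "\<And>s. s \<in> S \<Longrightarrow> cadj s \<in> S"
    and A: "op.subspace A" "\<And>a b. a \<in> A \<Longrightarrow> b \<in> A \<Longrightarrow> a ** b \<in> A" "\<And>a. a \<in> A \<Longrightarrow> cadj a \<in> A" "mat 1 \<in> A"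
    using SA by (auto simp: quantum_graph_def operator_system_def von_neumann_algebra_def
        star_subset_iff mult_subset_iff)
  have T: "op.subspace T" "mat 1 \<in> T"
    and B: "op.subspace B" "\<And>a b. a \<in> B \<Longrightarrow> b \<in> B \<Longrightarrow> a ** b \<in> B" "\<And>a. a \<in> B \<Longrightarrow> cadj a \<in> B" "mat 1 \<in> B"
    using TB by (auto simp: quantum_graph_def operator_system_def von_neumann_algebra_def
        star_subset_iff mult_subset_iff)
  note XTX = XTX[unfolded mult_adj_subset_iff, rule_format]
    and XSX = XSX[unfolded mult_adj_subset_iff, rule_format]
    and XBX = XBX[unfolded mult_adj_subset_iff, rule_format]
    and XAX = XAX[unfolded mult_adj_subset_iff, rule_format]
  \<comment> \<open>Demanding both one-sided conditions makes \<open>C\<close> closed under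
    adjoints.\<close>
  define C where "C = {c \<in> A. \<forall>s\<in>S. s ** c \<in> S \<and> c ** s \<in> S}"
  have CA: "c \<in> A" if "c \<in> C" for c using that by (simp add: C_def)
  have C_adj: "cadj c \<in> C" if "c \<in> C" for c
    using that unfolding C_def by (simp add: A) (metis S(2) cadj_cadj cadj_mult)
  have C_mult: "c ** d \<in> C" if "c \<in> C" "d \<in> C" for c d
    using that unfolding C_def by (simp add: A) (metis matrix_mul_assoc)
  have C1: "mat 1 \<in> C" by (simp add: C_def A)
  have SXX: "s ** (cadj x ** y) \<in> S" if "s \<in> S" "x \<in> X" "y \<in> X" for s x y
  proof -
    \<comment> \<open>Inserting the identity on the left regroups the product so that
      \<open>v i ** s ** cadj x\<close> lies in \<open>T\<close>; the outer factors then lead back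
      into \<open>S\<close>.\<close>
    have "s ** (cadj x ** y) = (\<Sum>i<r. cadj (v i) ** v i) ** (s ** (cadj x ** y))"
      unfolding v(2) by simp
    also have "\<dots> = (\<Sum>i<r. cadj (v i) ** (v i ** s ** cadj x) ** y)"
      by (simp add: matrix_sum_mult matrix_mul_assoc)
    also have "\<dots> \<in> S"
      using that v(1) by (intro op.subspace_sum[OF S(1)] XTX XSX) auto
    finally show ?thesis .
  qed
  have XXC: "cadj x ** y \<in> C" if "x \<in> X" "y \<in> X" for x y
  proof -
    have "cadj x ** y \<in> A" using XBX[OF that(1) B(4) that(2)] by simp
    \<comment> \<open>Left multiplication follows from right multiplication by taking adjoints in
      \<open>S\<close>.\<close>
    moreover have "(cadj x ** y) ** s \<in> S" if "s \<in> S" for s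
      using S(2)[OF SXX[OF S(2)[OF that] \<open>y \<in> X\<close> \<open>x \<in> X\<close>]] by (simp add: cadj_mult matrix_mul_assoc)
    ultimately show ?thesis using SXX that by (simp add: C_def)
  qed
  \<comment> \<open>\<open>X\<close> need not be closed under the triple product; the right factors
    from \<open>C\<close> absorb \<open>cadj x ** y\<close>.\<close>
  define M where "M = op.span (X \<odot> C)"
  have M: "op.subspace M" unfolding M_def by (rule op.subspace_span)
  have XC: "x ** c \<in> M" if "x \<in> X" "c \<in> C" for x c
    unfolding M_def by (rule op.span_base) (use that in \<open>auto simp: op_set_mult_def\<close>)
  have XM: "x \<in> M" if "x \<in> X" for x using XC[OF that C1] by simp
  have MTM: "cadj m ** t ** n \<in> S" if "m \<in> M" "t \<in> T" "n \<in> M" for m t n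
  proof (rule op_span_sandwich[OF S(1) _ that(1)[unfolded M_def] that(3)[unfolded M_def]])
    fix g g' assume "g \<in> X \<odot> C" "g' \<in> X \<odot> C"
    then obtain x c x' c' where g: "g = x ** c" "g' = x' ** c'" "x \<in> X" "c \<in> C" "x' \<in> X" "c' \<in> C"
      by (auto simp: op_set_mult_def)
    then have "cadj c ** (cadj x ** t ** x') ** c' \<in> S"
      using XTX that(2) C_adj[of c] unfolding C_def by simp
    then show "cadj g ** t ** g' \<in> S" by (simp add: g cadj_mult matrix_mul_assoc)
  qed
  have MBM: "cadj m ** t ** n \<in> A" if "m \<in> M" "t \<in> B" "n \<in> M" for m t n
  proof (rule op_span_sandwich[OF A(1) _ that(1)[unfolded M_def] that(3)[unfolded M_def]])
    fix g g' assume "g \<in> X \<odot> C" "g' \<in> X \<odot> C"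
    then obtain x c x' c' where g: "g = x ** c" "g' = x' ** c'" "x \<in> X" "c \<in> C" "x' \<in> X" "c' \<in> C"
      by (auto simp: op_set_mult_def)
    then have "cadj c ** (cadj x ** t ** x') ** c' \<in> A"
      using XBX that(2) by (simp add: A CA)
    then show "cadj g ** t ** g' \<in> A" by (simp add: g cadj_mult matrix_mul_assoc)
  qed
  have MSM: "m ** s ** cadj n \<in> T" if "m \<in> M" "s \<in> S" "n \<in> M" for m s n
  proof (rule op_span_sandwich_adj[OF T(1) _ that(1)[unfolded M_def] that(3)[unfolded M_def]])
    fix g g' assume "g \<in> X \<odot> C" "g' \<in> X \<odot> C"
    then obtain x c x' c' where g: "g = x ** c" "g' = x' ** c'" "x \<in> X" "c \<in> C" "x' \<in> X" "c' \<in> C"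
      by (auto simp: op_set_mult_def)
    then have "c ** s ** cadj c' \<in> S" using that(2) C_adj[of c'] unfolding C_def by simp
    then have "x ** (c ** s ** cadj c') ** cadj x' \<in> T" using XSX g by simp
    then show "g ** s ** cadj g' \<in> T" by (simp add: g cadj_mult matrix_mul_assoc)
  qed
  have MAM: "m ** s ** cadj n \<in> B" if "m \<in> M" "s \<in> A" "n \<in> M" for m s n
  proof (rule op_span_sandwich_adj[OF B(1) _ that(1)[unfolded M_def] that(3)[unfolded M_def]])
    fix g g' assume "g \<in> X \<odot> C" "g' \<in> X \<odot> C"
    then obtain x c x' c' where g: "g = x ** c" "g' = x' ** c'" "x \<in> X" "c \<in> C" "x' \<in> X" "c' \<in> C"
      by (auto simp: op_set_mult_def)
    then have "c ** s ** cadj c' \<in> A" using that(2) by (simp add: A CA)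
    then have "x ** (c ** s ** cadj c') ** cadj x' \<in> B" using XAX g by simp
    then show "g ** s ** cadj g' \<in> B" by (simp add: g cadj_mult matrix_mul_assoc)
  qed
  have bim: "b ** m ** a \<in> M" if "b \<in> commutant B" "m \<in> M" "a \<in> commutant A" for b m a
  proof (rule op_span_mult[OF M _ that(2)[unfolded M_def]])
    fix g assume "g \<in> X \<odot> C"
    then obtain x c where g: "g = x ** c" "x \<in> X" "c \<in> C" by (auto simp: op_set_mult_def)
    have "b ** g ** a = (b ** x) ** (c ** a)" by (simp add: g matrix_mul_assoc)
    \<comment> \<open>\<open>c\<close> lies in \<open>A\<close> and so commutes with
      \<open>a\<close>, which is then absorbed by \<open>X\<close>.\<close>
    also have "c ** a = a ** c" using commutantD[OF that(3) CA[OF g(3)]] by simp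
    also have "(b ** x) ** (a ** c) = (b ** x ** a) ** c" by (simp add: matrix_mul_assoc)
    also have "\<dots> \<in> M" using XC X that g by simp
    finally show "b ** g ** a \<in> M" .
  qed
  have MMM: "m1 ** cadj m2 ** m3 \<in> M" if m: "m1 \<in> M" "m2 \<in> M" "m3 \<in> M" for m1 m2 m3
  proof -
    \<comment> \<open>These products are combinations of elements of \<open>C\<close>, and right
      multiplication by \<open>C\<close> preserves \<open>M\<close>.\<close>
    have MC: "cadj m2 ** m3 \<in> {c. \<forall>m\<in>M. m ** c \<in> M}"
    proof -
      have sub: "op.subspace {c. \<forall>m\<in>M. m ** c \<in> M}"
        using M unfolding op.subspace_def by (auto simp: matrix_add_ldistrib op_scale_mult_right)
      have "cadj m2 ** mat 1 ** m3 \<in> {c. \<forall>m\<in>M. m ** c \<in> M}"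
      proof (rule op_span_sandwich[OF sub _ m(2)[unfolded M_def] m(3)[unfolded M_def]])
        fix g g' assume "g \<in> X \<odot> C" "g' \<in> X \<odot> C"
        then obtain x c x' c' where g: "g = x ** c" "g' = x' ** c'" "x \<in> X" "c \<in> C" "x' \<in> X" "c' \<in> C"
          by (auto simp: op_set_mult_def)
        have e: "cadj g ** mat 1 ** g' = cadj c ** (cadj x ** x') ** c'"
          by (simp add: g cadj_mult matrix_mul_assoc)
        have eC: "cadj c ** (cadj x ** x') ** c' \<in> C"
          using g by (intro C_mult C_adj XXC)
        have "mat 1 ** m ** (cadj c ** (cadj x ** x') ** c') \<in> M" if "m \<in> M" for m
        proof (rule op_span_mult[OF M _ that[unfolded M_def]])
          fix y assume "y \<in> X \<odot> C"
          then obtain u d where "y = u ** d" "u \<in> X" "d \<in> C" by (auto simp: op_set_mult_def)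
          then show "mat 1 ** y ** (cadj c ** (cadj x ** x') ** c') \<in> M"
            using XC[OF _ C_mult[OF _ eC]] by (simp add: matrix_mul_assoc)
        qed
        then show "cadj g ** mat 1 ** g' \<in> {c. \<forall>m\<in>M. m ** c \<in> M}" unfolding e by simp
      qed
      then show ?thesis by simp
    qed
    then show ?thesis using m(1) by (simp add: matrix_mul_assoc)
  qed
  have TRO: "TRO M"
    unfolding TRO_def mult_adj_subset_iff using M closed_op_subspace[OF M] MMM by blast
  have right: "mat 1 \<in> op.span (M\<^sup>\<star> \<odot> M)"
    unfolding v(2)[symmetric]
    by (intro op.subspace_sum[OF op.subspace_span] op.span_base)
      (use v(1) XM in \<open>unfold op_set_mult_def op_set_adj_def, blast\<close>)
  \<comment> \<open>\<open>D\<close> is a selfadjoint algebra inside \<open>B\<close>. It has a unit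
    \<open>p\<close>, and faithfulness can be applied to \<open>mat 1 - p\<close> because this lies
    in \<open>B\<close>.\<close>
  define D where "D = op.span (M \<odot> M\<^sup>\<star>)"
  have D: "op.subspace D" unfolding D_def by (rule op.subspace_span)
  have MD: "m ** cadj n \<in> D" if "m \<in> M" "n \<in> M" for m n
    unfolding D_def by (rule op.span_base) (use that in \<open>auto simp: op_set_mult_def op_set_adj_def\<close>)
  have DB: "D \<subseteq> B"
    unfolding D_def using MAM[OF _ A(4)]
    by (intro op.span_minimal B(1)) (auto simp: op_set_mult_def op_set_adj_def)
  have DM: "d ** m \<in> M" if "d \<in> D" "m \<in> M" for d m
    using op_span_mult[OF M _ that(1)[unfolded D_def], of "mat 1" m] MMM that(2)
    by (auto simp: op_set_mult_def op_set_adj_def)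
  have D_mult: "d ** e \<in> D" if "d \<in> D" "e \<in> D" for d e
  proof -
    have "d ** g ** mat 1 \<in> D" if "g \<in> M \<odot> M\<^sup>\<star>" for g
      using that MD DM \<open>d \<in> D\<close> by (auto simp: op_set_mult_def op_set_adj_def matrix_mul_assoc)
    from op_span_mult[OF D this that(2)[unfolded D_def]] show ?thesis by simp
  qed
  have D_adj: "cadj d \<in> D" if "d \<in> D" for d
  proof -
    have "mat 1 ** cadj g ** mat 1 \<in> D" if "g \<in> M \<odot> M\<^sup>\<star>" for g
      using that MD by (auto simp: op_set_mult_def op_set_adj_def cadj_mult)
    from op_span_mult_adj[OF D this that[unfolded D_def]] show ?thesis by simp
  qed
  obtain p where p: "p \<in> D" "\<And>d. d \<in> D \<Longrightarrow> p ** d = d"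
    using star_algebra_unit[of D] D D_mult D_adj by (auto simp: star_subset_iff)
  have "mat 1 - p = 0"
  proof (rule faith)
    show "mat 1 - p \<in> B" using B p DB by (auto simp: op.subspace_diff)
    fix i assume "i < r"
    then have vM: "v i \<in> M" using v XM by simp
    let ?b = "mat 1 - p"
    \<comment> \<open>As \<open>p\<close> fixes \<open>v i ** cadj (v i)\<close>, the product of
      \<open>?b ** v i\<close> with its own adjoint vanishes.\<close>
    have "?b ** (v i ** cadj (v i)) = 0" using p(2)[OF MD[OF vM vM]] by (simp add: matrix_diff_rdistrib)
    then have "cadj (cadj (?b ** v i)) ** cadj (?b ** v i) = 0"
      by (simp add: cadj_mult matrix_mul_assoc)
    then have "cadj (?b ** v i) = 0" by (rule cadj_mult_self_eq_0)
    then show "?b ** v i = 0" by (metis cadj_cadj cadj_zero)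
  qed
  then have "mat 1 \<in> D" using p(1) by simp
  then have nd: "nondegenerate M"
    unfolding nondegenerate_def closed_span_eq_span using right by (simp add: D_def)
  show ?thesis
    using TRO nd bim MTM MSM MBM MAM
    unfolding bimodule_def mult_adj_subset_iff by (intro exI[of _ M] conjI) blast+
qed

section \<open>From a TRO to a faithful map\<close>

lemma norm_sq_columns:
  fixes x :: "complex ^ 'n ^ 'm"
  shows "(norm x)\<^sup>2 = (\<Sum>j\<in>UNIV. (norm (column j x))\<^sup>2)"
  by (simp add: norm_vec_def L2_set_def sum_nonneg column_def) (rule sum.swap)

lemma norm_cadj [simp]: "norm (cadj x) = norm x"
  by (simp add: norm_vec_def L2_set_def sum_nonneg) (rule sum.swap)

text \<open>Left multiplication acts column by column, so a bound on vectors carries over to the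
  Hilbert-Schmidt norm, in which the contraction is measured later.\<close>

lemma norm_mult_le_left:
  fixes x :: "complex ^ 'n ^ 'm" and y :: "complex ^ 'p ^ 'n"
  assumes "0 \<le> q" "\<And>\<xi>. norm (x *v \<xi>) \<le> q * norm \<xi>"
  shows "norm (x ** y) \<le> q * norm y"
proof (rule power2_le_imp_le)
  have col: "column j (x ** y) = x *v column j y" for j
    by (simp add: column_def vec_eq_iff matrix_matrix_mult_def matrix_vector_mult_def)
  have "(norm (x ** y))\<^sup>2 \<le> (\<Sum>j\<in>UNIV. (q * norm (column j y))\<^sup>2)"
    unfolding norm_sq_columns[of "x ** y"] col by (intro sum_mono power_mono assms) auto
  then show "(norm (x ** y))\<^sup>2 \<le> (q * norm y)\<^sup>2"
    by (simp add: norm_sq_columns[of y] power_mult_distrib sum_distrib_left)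
qed (use assms in simp)

text \<open>Taking adjoints preserves the norm and turns right multiplication by the selfadjoint
  \<open>x\<close> into left multiplication.\<close>

lemma norm_mult_le_right:
  fixes x :: "complex ^ 'n ^ 'n" and y :: "complex ^ 'n ^ 'm"
  assumes "0 \<le> q" "\<And>\<xi>. norm (x *v \<xi>) \<le> q * norm \<xi>" "cadj x = x"
  shows "norm (y ** x) \<le> q * norm y"
  using norm_mult_le_left[OF assms(1,2), of "cadj y"] norm_cadj[of "y ** x"]
  by (simp add: cadj_mult assms(3))

lemma scaleR_matrix_vector: "(r *\<^sub>R x) *v \<xi> = r *\<^sub>R (x *v (\<xi> :: complex ^ 'n))"
  by (simp add: vec_eq_iff matrix_vector_mult_def scaleR_sum_right)

text \<open>With \<open>c P = 1 - Q\<close> and \<open>\<parallel>Q\<parallel> < 1\<close>, the contraction \<open>Y \<mapsto> (Q + Y\<^sup>2) / 2\<close> has a fixed point,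
  for which \<open>(1 - Y)\<^sup>2 = c P\<close>.\<close>

lemma algebra_inverse_sqrt:
  fixes E :: "(complex ^ 'n ^ 'n) set"
  assumes E: "subspace E" "\<And>x y. x \<in> E \<Longrightarrow> y \<in> E \<Longrightarrow> x ** y \<in> E" "mat 1 \<in> E"
    and P: "P \<in> E" "cadj P = P" "\<And>\<xi>. \<xi> \<noteq> 0 \<Longrightarrow> inner \<xi> (P *v \<xi>) > 0"
  shows "\<exists>G\<in>E. cadj G ** P ** G = mat 1"
proof -
  have cont: "continuous_on UNIV (\<lambda>\<xi>. P *v \<xi>)"
    unfolding matrix_vector_mult_def by (intro continuous_intros)
  have "sphere (0 :: complex ^ 'n) 1 \<noteq> {}" by simp
  moreover have "continuous_on (sphere 0 1) (\<lambda>\<xi>. inner \<xi> (P *v \<xi>))"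
    by (intro continuous_intros continuous_on_subset[OF cont]) auto
  ultimately obtain \<eta> where \<eta>: "norm \<eta> = 1"
    "\<And>\<xi>. norm \<xi> = 1 \<Longrightarrow> inner \<eta> (P *v \<eta>) \<le> inner \<xi> (P *v \<xi>)"
    using continuous_attains_inf[OF compact_sphere, of 0 1 "\<lambda>\<xi>. inner \<xi> (P *v \<xi>)"] by auto
  define m where "m = inner \<eta> (P *v \<eta>)"
  have m: "m > 0" unfolding m_def using \<eta>(1) by (intro P) auto
  have Pm: "m * (norm \<xi>)\<^sup>2 \<le> inner \<xi> (P *v \<xi>)" for \<xi>
  proof (cases "\<xi> = 0")
    case False
    let ?u = "(1 / norm \<xi>) *\<^sub>R \<xi>"
    have Pu: "P *v ?u = (1 / norm \<xi>) *\<^sub>R (P *v \<xi>)"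
      by (simp add: vec_eq_iff matrix_vector_mult_def scaleR_sum_right)
    have "inner ?u (P *v ?u) = inner \<xi> (P *v \<xi>) / (norm \<xi>)\<^sup>2"
      unfolding Pu by (simp add: power2_eq_square)
    moreover have "m \<le> inner ?u (P *v ?u)"
      unfolding m_def using False by (intro \<eta>(2)) simp
    ultimately have "m \<le> inner \<xi> (P *v \<xi>) / (norm \<xi>)\<^sup>2" by simp
    then show ?thesis using False by (simp add: field_simps)
  qed simp
  obtain L where L: "L > 0" "\<And>\<xi>. norm (P *v \<xi>) \<le> L * norm \<xi>"
    using matrix_vector_bound[of P] by blast
  have mL: "m \<le> L"
  proof -
    have "m \<le> norm \<eta> * norm (P *v \<eta>)" unfolding m_def by (rule norm_cauchy_schwarz)
    also have "\<dots> \<le> L" using L(2)[of \<eta>] \<eta>(1) by simp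
    finally show ?thesis .
  qed
  \<comment> \<open>This \<open>c\<close> minimises 1 - 2cm + c^2 L^2, the factor in the estimate of
    the squared norm of \<open>Q *v \<xi>\<close>; the minimum is the square of \<open>q\<close>.
    The bound \<open>mL\<close> keeps the radicand of \<open>q\<close> nonnegative.\<close>
  define c where "c = m / L\<^sup>2"
  have c: "c > 0" using m L by (simp add: c_def)
  define q where "q = sqrt (1 - m\<^sup>2 / L\<^sup>2)"
  have mL2: "0 < m\<^sup>2 / L\<^sup>2" "m\<^sup>2 / L\<^sup>2 \<le> 1"
    using m L(1) mL by (simp_all add: power_mono)
  have q: "0 \<le> q" "q < 1" unfolding q_def using mL2 by (simp_all add: real_sqrt_less_iff)
  have q2: "q\<^sup>2 = 1 - m\<^sup>2 / L\<^sup>2" unfolding q_def using mL2 by simp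
  define Q where "Q = mat 1 - c *\<^sub>R P"
  have QE: "Q \<in> E" unfolding Q_def using E P by (simp add: subspace_diff subspace_scale)
  have Qadj: "cadj Q = Q" by (simp add: Q_def cadj_diff cadj_scaleR P)
  have Qq: "norm (Q *v \<xi>) \<le> q * norm \<xi>" for \<xi>
  proof (rule power2_le_imp_le)
    have Qx: "Q *v \<xi> = \<xi> - c *\<^sub>R (P *v \<xi>)"
      by (simp add: Q_def matrix_vector_mult_diff_rdistrib scaleR_matrix_vector)
    have "(norm (Q *v \<xi>))\<^sup>2 = (norm \<xi>)\<^sup>2 - 2 * c * inner \<xi> (P *v \<xi>) + c\<^sup>2 * (norm (P *v \<xi>))\<^sup>2"
      unfolding Qx power2_norm_eq_inner
      by (simp add: inner_diff_left inner_diff_right inner_commute power2_eq_square)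
    also have "\<dots> \<le> (norm \<xi>)\<^sup>2 - 2 * c * (m * (norm \<xi>)\<^sup>2) + c\<^sup>2 * (L * norm \<xi>)\<^sup>2"
      using c Pm[of \<xi>] power_mono[OF L(2)[of \<xi>], of 2]
      by (intro add_mono diff_mono mult_left_mono) auto
    also have "\<dots> = (q * norm \<xi>)\<^sup>2"
      unfolding power_mult_distrib q2 c_def using L(1) by (simp add: field_simps power2_eq_square)
    finally show "(norm (Q *v \<xi>))\<^sup>2 \<le> (q * norm \<xi>)\<^sup>2" .
  qed (use q in simp)
  \<comment> \<open>The fixed point has to be selfadjoint and in \<open>E\<close>, so both
    conditions are built into the complete set. The bound \<open>q\<close> survives \<open>F\<close>
    because the mean of \<open>q\<close> and its square is at most \<open>q\<close>.\<close>
  define U where "U = {Y \<in> E. cadj Y = Y \<and> (\<forall>\<xi>. norm (Y *v \<xi>) \<le> q * norm \<xi>)}"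
  define F where "F Y = (1/2) *\<^sub>R (Q + Y ** Y)" for Y
  have "closed U"
  proof -
    have "U = E \<inter> {Y. cadj Y = Y} \<inter> (\<Inter>\<xi>. {Y. norm (Y *v \<xi>) \<le> q * norm \<xi>})"
      by (auto simp: U_def)
    moreover have "closed {Y :: complex ^ 'n ^ 'n. cadj Y = Y}"
      unfolding cadj_def by (intro closed_Collect_eq continuous_intros)
    moreover have "closed {Y :: complex ^ 'n ^ 'n. norm (Y *v \<xi>) \<le> q * norm \<xi>}" for \<xi>
      unfolding matrix_vector_mult_def by (intro closed_Collect_le continuous_intros)
    ultimately show ?thesis using closed_subspace[OF E(1)] by (simp add: closed_INT closed_Int)
  qed
  then have "complete U" by (simp add: complete_eq_closed)
  moreover have "U \<noteq> {}" using QE Qadj Qq by (auto simp: U_def)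
  moreover have "F ` U \<subseteq> U"
  proof
    fix Z assume "Z \<in> F ` U"
    then obtain Y where Y: "Y \<in> U" "Z = F Y" by auto
    have "norm (F Y *v \<xi>) \<le> q * norm \<xi>" for \<xi>
    proof -
      have "norm (F Y *v \<xi>) = (1/2) * norm (Q *v \<xi> + Y *v (Y *v \<xi>))"
        by (simp add: F_def scaleR_matrix_vector matrix_vector_mult_add_rdistrib matrix_vector_mul_assoc)
      also have "\<dots> \<le> (1/2) * (norm (Q *v \<xi>) + norm (Y *v (Y *v \<xi>)))"
        by (simp add: norm_triangle_ineq)
      also have "\<dots> \<le> (1/2) * (q * norm \<xi> + q * (q * norm \<xi>))"
      proof -
        have "norm (Y *v (Y *v \<xi>)) \<le> q * norm (Y *v \<xi>)" using Y by (simp add: U_def)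
        also have "\<dots> \<le> q * (q * norm \<xi>)" using Y q by (intro mult_left_mono) (auto simp: U_def)
        finally show ?thesis using Qq[of \<xi>] by simp
      qed
      also have "\<dots> \<le> q * norm \<xi>"
        using mult_right_mono[of q 1 "q * norm \<xi>"] q by simp
      finally show ?thesis .
    qed
    then show "Z \<in> U"
      using Y E QE Qadj
      by (auto simp: U_def F_def subspace_add subspace_scale cadj_scaleR cadj_add cadj_mult)
  qed
  moreover have "dist (F Y) (F Z) \<le> q * dist Y Z" if YZ: "Y \<in> U" "Z \<in> U" for Y Z
  proof -
    \<comment> \<open>This splitting of Y^2 - Z^2 is valid without commutativity.\<close>
    have "F Y - F Z = (1/2) *\<^sub>R (Y ** (Y - Z) + (Y - Z) ** Z)"
      by (simp add: F_def matrix_diff_ldistrib matrix_diff_rdistrib algebra_simps flip: scaleR_diff_right)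
    then have "dist (F Y) (F Z) = (1/2) * norm (Y ** (Y - Z) + (Y - Z) ** Z)"
      by (simp add: dist_norm)
    also have "\<dots> \<le> (1/2) * (norm (Y ** (Y - Z)) + norm ((Y - Z) ** Z))"
      by (simp add: norm_triangle_ineq)
    also have "\<dots> \<le> (1/2) * (q * norm (Y - Z) + q * norm (Y - Z))"
      using YZ q unfolding U_def
      by (intro mult_left_mono add_mono norm_mult_le_left norm_mult_le_right) auto
    finally show ?thesis by (simp add: dist_norm)
  qed
  ultimately have "\<exists>!Y\<in>U. F Y = Y" by (intro Banach_fix[OF _ _ q])
  then obtain Y where Y: "Y \<in> U" "F Y = Y" by blast
  define R where "R = mat 1 - Y"
  have RE: "R \<in> E" unfolding R_def using Y E by (auto simp: U_def subspace_diff)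
  have Radj: "cadj R = R" using Y by (simp add: R_def cadj_diff U_def)
  have RR: "R ** R = c *\<^sub>R P"
  proof -
    have "Y + Y = 2 *\<^sub>R F Y" using Y by (simp add: scaleR_2)
    also have "\<dots> = Q + Y ** Y" by (simp add: F_def)
    finally have "Y ** Y = Y + Y - Q" by (simp add: algebra_simps)
    then show ?thesis
      by (simp add: R_def Q_def matrix_diff_ldistrib matrix_diff_rdistrib)
  qed
  have "\<xi> = 0" if "R *v \<xi> = 0" for \<xi>
  proof (rule ccontr)
    assume "\<xi> \<noteq> 0"
    have "(R ** R) *v \<xi> = 0" using that by (simp flip: matrix_vector_mul_assoc)
    then have "P *v \<xi> = 0" using c by (simp add: RR scaleR_matrix_vector)
    then show False using P(3)[OF \<open>\<xi> \<noteq> 0\<close>] by simp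
  qed
  then obtain R' where R': "R' ** R = mat 1"
    using matrix_left_invertible_ker[of R] by blast
  \<comment> \<open>Left multiplication by \<open>R\<close> maps \<open>E\<close> injectively into
    itself, hence onto by dimension; so \<open>E\<close> contains the inverse of
    \<open>R\<close>.\<close>
  have lin: "linear (\<lambda>e. R ** e)"
    by (rule linearI) (simp_all add: matrix_add_ldistrib scaleR_eq_op_scale op_scale_mult_right)
  have "inj (\<lambda>e :: complex ^ 'n ^ 'n. R ** e)"
  proof (rule injI)
    fix x y assume "R ** x = R ** y"
    then have "R' ** (R ** x) = R' ** (R ** y)" by simp
    then show "x = y" by (simp add: matrix_mul_assoc R')
  qed
  then have dim: "dim ((\<lambda>e. R ** e) ` E) = dim E"
    by (intro dim_image_eq[OF lin]) (rule inj_on_subset[OF _ subset_UNIV])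
  have "(\<lambda>e. R ** e) ` E = E"
  proof (rule subspace_dim_equal)
    show "subspace ((\<lambda>e. R ** e) ` E)" by (rule linear_subspace_image[OF lin E(1)])
    show "(\<lambda>e. R ** e) ` E \<subseteq> E" using E(2)[OF RE] by blast
  qed (use E(1) dim in simp_all)
  then obtain N where N: "N \<in> E" "R ** N = mat 1" using E(3) by (metis imageE)
  have Nadj: "cadj N = N"
  proof -
    have "cadj N ** R = mat 1" using arg_cong[OF N(2), of cadj] by (simp add: cadj_mult Radj)
    then show ?thesis by (metis N(2) matrix_mul_assoc matrix_mul_lid matrix_mul_rid)
  qed
  have NR: "N ** R = mat 1" using N(2) by (simp add: matrix_left_right_inverse)
  show ?thesis
  proof (rule bexI)
    show "sqrt c *\<^sub>R N \<in> E" using E N by (simp add: subspace_scale)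
    have "cadj (sqrt c *\<^sub>R N) ** P ** (sqrt c *\<^sub>R N) = N ** (c *\<^sub>R P) ** N"
      using c unfolding scaleR_eq_op_scale cadj_scale op_scale_mult_left op_scale_mult_right Nadj
      by (simp flip: of_real_mult)
    also have "\<dots> = (N ** R) ** (R ** N)" unfolding RR[symmetric] by (simp only: matrix_mul_assoc)
    finally show "cadj (sqrt c *\<^sub>R N) ** P ** (sqrt c *\<^sub>R N) = mat 1" by (simp add: N NR)
  qed
qed

text \<open>The two halves of non-degeneracy serve different conclusions: the identity in the span
  of \<open>M\<^sup>\<star> \<odot> M\<close> makes \<open>P\<close> positive definite, and the
  identity in the span of \<open>M \<odot> M\<^sup>\<star>\<close> makes the \<open>w i\<close>
  detect every \<open>b\<close>.\<close>

lemma TRO_frame: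
  fixes M :: "(complex ^ 'h ^ 'k) set"
  assumes TRO: "TRO M" and nd: "nondegenerate M"
  obtains r w where "\<And>i. i < (r::nat) \<Longrightarrow> w i \<in> M" "(\<Sum>i<r. cadj (w i) ** w i) = mat 1"
    "\<And>b :: complex ^ 'k ^ 'k. (\<And>i. i < r \<Longrightarrow> b ** w i = 0) \<Longrightarrow> b = 0"
proof -
  have M: "op.subspace M" "subspace M"
    using TRO op_subspace_imp_subspace by (auto simp: TRO_def)
  have MMM: "x ** cadj y ** z \<in> M" if "x \<in> M" "y \<in> M" "z \<in> M" for x y z
    using TRO that by (simp add: TRO_def mult_adj_subset_iff)
  have one: "mat 1 \<in> op.span (M\<^sup>\<star> \<odot> M)" "mat 1 \<in> op.span (M \<odot> M\<^sup>\<star>)"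
    using nd by (simp_all add: nondegenerate_def closed_span_eq_span)
  define E where "E = op.span (M\<^sup>\<star> \<odot> M)"
  have E: "op.subspace E" unfolding E_def by (rule op.subspace_span)
  have ME: "cadj m ** n \<in> E" if "m \<in> M" "n \<in> M" for m n
    unfolding E_def by (rule op.span_base) (use that in \<open>auto simp: op_set_mult_def op_set_adj_def\<close>)
  have MEM: "m ** e \<in> M" if "m \<in> M" "e \<in> E" for m e
  proof -
    have "m ** g ** mat 1 \<in> M" if "g \<in> M\<^sup>\<star> \<odot> M" for g
      using that MMM \<open>m \<in> M\<close> by (auto simp: op_set_mult_def op_set_adj_def matrix_mul_assoc)
    from op_span_mult[OF M(1) this that(2)[unfolded E_def]] show ?thesis by simp
  qed
  have E_mult: "d ** e \<in> E" if "d \<in> E" "e \<in> E" for d e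
  proof -
    have "mat 1 ** g ** e \<in> E" if "g \<in> M\<^sup>\<star> \<odot> M" for g
      using that ME MEM[OF _ \<open>e \<in> E\<close>]
      by (auto simp: op_set_mult_def op_set_adj_def simp flip: matrix_mul_assoc)
    from op_span_mult[OF E this that(1)[unfolded E_def]] show ?thesis by simp
  qed
  \<comment> \<open>A real basis suffices, since the conditions later extended from the
    \<open>v i\<close> to \<open>M\<close> define real subspaces.\<close>
  obtain Bs where Bs: "Bs \<subseteq> M" "independent Bs" "M \<subseteq> span Bs"
    by (rule basis_exists[of M])
  then obtain vs where vs: "set vs = Bs" using independent_imp_finite finite_list by blast
  define r where "r = length vs"
  define v where "v i = vs ! i" for i
  have vM: "v i \<in> M" if "i < r" for i
    using that vs Bs by (auto simp: v_def r_def)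
  have ind: "m \<in> V" if "subspace V" "\<And>i. i < r \<Longrightarrow> v i \<in> V" "m \<in> M" for V m
  proof -
    have "Bs \<subseteq> V" using that(2) by (auto simp: vs[symmetric] v_def r_def in_set_conv_nth)
    then show ?thesis using Bs span_minimal[OF _ that(1)] that(3) by blast
  qed
  define P where "P = (\<Sum>i<r. cadj (v i) ** v i)"
  have PE: "P \<in> E" unfolding P_def by (intro op.subspace_sum[OF E] ME vM) auto
  have Padj: "cadj P = P" by (simp add: P_def cadj_sum cadj_mult)
  \<comment> \<open>Otherwise every \<open>v i\<close> kills \<open>\<xi>\<close>, hence so does all
    of \<open>M\<close>, and then so does the identity.\<close>
  have Ppos: "inner \<xi> (P *v \<xi>) > 0" if "\<xi> \<noteq> 0" for \<xi>
  proof (rule ccontr)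
    assume neg: "\<not> inner \<xi> (P *v \<xi>) > 0"
    have "cinner \<xi> ((cadj m ** m) *v \<xi>) = of_real ((norm (m *v \<xi>))\<^sup>2)" for m :: "complex ^ 'h ^ 'k"
      by (simp add: cinner_adj[of _ "cadj m"] cinner_self flip: matrix_vector_mul_assoc)
    then have nv: "inner \<xi> ((cadj m ** m) *v \<xi>) = (norm (m *v \<xi>))\<^sup>2" for m :: "complex ^ 'h ^ 'k"
      unfolding Re_cinner[symmetric] by simp
    have Ps: "sum f I *v \<xi> = (\<Sum>i\<in>I. f i *v \<xi>)" for f :: "nat \<Rightarrow> complex ^ 'h ^ 'h" and I
      by (induction I rule: infinite_finite_induct) (simp_all add: matrix_vector_mult_add_rdistrib)
    have "inner \<xi> (P *v \<xi>) = (\<Sum>i<r. (norm (v i *v \<xi>))\<^sup>2)"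
      by (simp add: P_def Ps inner_sum_right nv)
    then have "(\<Sum>i<r. (norm (v i *v \<xi>))\<^sup>2) = 0"
      using neg by (simp add: sum_nonneg antisym)
    then have z: "v i *v \<xi> = 0" if "i < r" for i
      using that by (simp add: sum_nonneg_eq_0_iff)
    have "subspace {m. m *v \<xi> = 0}" for m :: "complex ^ 'h ^ 'k"
      by (auto simp: subspace_def matrix_vector_mult_add_rdistrib scaleR_matrix_vector)
    then have m0: "m *v \<xi> = 0" if "m \<in> M" for m
      using ind[of "{m. m *v \<xi> = 0}" m] z that by auto
    have "op.subspace {d. d *v \<xi> = 0}"
      by (auto simp: op.subspace_def vec_eq_iff matrix_vector_mult_def distrib_right sum.distrib
          mult.assoc simp flip: sum_distrib_left)
    then have "op.span (M\<^sup>\<star> \<odot> M) \<subseteq> {d. d *v \<xi> = 0}"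
      by (intro op.span_minimal) (auto simp: op_set_mult_def m0 simp flip: matrix_vector_mul_assoc)
    then have "(mat 1) *v \<xi> = 0" using one(1) by blast
    then show False using that by simp
  qed
  obtain G where G: "G \<in> E" "cadj G ** P ** G = mat 1"
    using algebra_inverse_sqrt[OF op_subspace_imp_subspace[OF E] E_mult one(1)[folded E_def] PE Padj Ppos]
    by blast
  \<comment> \<open>For square matrices a left inverse is a right inverse; thus
    \<open>b ** v i\<close> can be recovered from \<open>b ** (v i ** G)\<close>.\<close>
  have G': "G ** (cadj G ** P) = mat 1" using G(2) by (simp add: matrix_left_right_inverse)
  show thesis
  proof (rule that)
    show "v i ** G \<in> M" if "i < r" for i using MEM[OF vM[OF that] G(1)] .
    have "(\<Sum>i<r. cadj (v i ** G) ** (v i ** G)) = cadj G ** P ** G"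
      by (simp add: P_def matrix_sum_mult matrix_mult_sum_right cadj_mult matrix_mul_assoc)
    then show "(\<Sum>i<r. cadj (v i ** G) ** (v i ** G)) = mat 1" using G(2) by simp
    fix b :: "complex ^ 'k ^ 'k"
    assume b: "\<And>i. i < r \<Longrightarrow> b ** (v i ** G) = 0"
    have bv: "b ** v i = 0" if "i < r" for i
    proof -
      have "b ** v i = b ** (v i ** G) ** (cadj G ** P)"
        using G' by (simp add: matrix_mul_assoc) (metis matrix_mul_assoc matrix_mul_rid)
      then show ?thesis using b[OF that] by simp
    qed
    have "subspace {m. b ** m = 0}"
      by (auto simp: subspace_def matrix_add_ldistrib scaleR_eq_op_scale op_scale_mult_right)
    then have bm: "b ** m = 0" if "m \<in> M" for m using ind[of "{m. b ** m = 0}"] bv that by auto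
    have "b \<in> {0}"
      by (rule mult_unit_mem_span[OF one(2)]) (auto simp: bm)
    then show "b = 0" by simp
  qed
qed

section \<open>Maps defined by Kraus operators, and the equivalence\<close>

lemma completely_positive_kraus:
  assumes "kraus_operators B \<phi> r w" "op.subspace B"
  shows "completely_positive B \<phi>"
  unfolding completely_positive_def
proof (intro conjI allI impI)
  have ph: "\<phi> b = (\<Sum>i<r. cadj (w i) ** b ** w i)" if "b \<in> B" for b
    using assms(1) that by (simp add: kraus_operators_def)
  show "linear_map_on B \<phi>"
    using assms(2) unfolding linear_map_on_def
    by (auto simp: ph op.subspace_add op.subspace_scale matrix_add_ldistrib matrix_add_rdistrib
        sum.distrib op_scale_mult_left op_scale_mult_right op.scale_sum_right)
  fix n x assume x: "(\<forall>i<n. \<forall>j<n. x i j \<in> B) \<and> block_positive n x"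
  show "block_positive n (\<lambda>i j. \<phi> (x i j))"
    unfolding block_positive_def
  proof
    fix \<xi> :: "nat \<Rightarrow> complex ^ 'b"
    have Ps: "sum f I *v \<eta> = (\<Sum>i\<in>I. f i *v \<eta>)" for f :: "nat \<Rightarrow> complex ^ 'b ^ 'b" and I \<eta>
      by (induction I rule: infinite_finite_induct) (simp_all add: matrix_vector_mult_add_rdistrib)
    have Cs: "cinner \<eta> (sum f I) = (\<Sum>i\<in>I. cinner \<eta> (f i))" for f :: "nat \<Rightarrow> complex ^ 'b" and I \<eta>
      by (induction I rule: infinite_finite_induct) (simp_all add: cinner_def algebra_simps sum.distrib)
    have "(\<Sum>i<n. \<Sum>j<n. cinner (\<xi> i) (\<phi> (x i j) *v \<xi> j)) =
      (\<Sum>i<n. \<Sum>j<n. \<Sum>k<r. cinner (w k *v \<xi> i) (x i j *v (w k *v \<xi> j)))"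
      using x by (intro sum.cong refl)
        (simp add: ph Ps Cs cinner_adj[of _ "cadj _"] flip: matrix_vector_mul_assoc)
    also have "\<dots> = (\<Sum>k<r. \<Sum>i<n. \<Sum>j<n. cinner (w k *v \<xi> i) (x i j *v (w k *v \<xi> j)))"
      by (rule sum_swap3[symmetric])
    also have "\<dots> \<in> \<real>\<^sub>\<ge>\<^sub>0"
    proof -
      have "(\<Sum>i<n. \<Sum>j<n. cinner (w k *v \<xi> i) (x i j *v (w k *v \<xi> j))) \<in> \<real>\<^sub>\<ge>\<^sub>0" for k
        using x[THEN conjunct2, unfolded block_positive_def, rule_format, of "\<lambda>i. w k *v \<xi> i"] .
      then show ?thesis by (simp only: complex_nonneg_Reals_iff Re_sum Im_sum) (simp add: sum_nonneg)
    qed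
    finally show "(\<Sum>i<n. \<Sum>j<n. cinner (\<xi> i) (\<phi> (x i j) *v \<xi> j)) \<in> \<real>\<^sub>\<ge>\<^sub>0" .
  qed
qed

text \<open>The trace turns the sum into a sum of squared norms.\<close>

lemma sum_cadj_mult_self_eq_0:
  assumes "finite I" "(\<Sum>i\<in>I. cadj (x i) ** x i) = 0" "i \<in> I"
  shows "x i = 0"
proof -
  have "(\<Sum>i\<in>I. of_real ((norm (x i))\<^sup>2)) = trace (\<Sum>i\<in>I. cadj (x i) ** x i)"
    unfolding hs_self[symmetric] hs_trace trace_def sum_component by (rule sum.swap)
  also have "\<dots> = 0" by (simp add: assms(2) trace_def)
  finally have "(of_real (\<Sum>i\<in>I. (norm (x i))\<^sup>2) :: complex) = 0" by simp
  then have "(\<Sum>i\<in>I. (norm (x i))\<^sup>2) = 0" by (simp only: of_real_eq_0_iff)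
  then show ?thesis using assms by (simp add: sum_nonneg_eq_0_iff)
qed

theorem theoremB:
  fixes S A :: "(complex ^ 'h ^ 'h) set" and T B :: "(complex ^ 'k ^ 'k) set"
  assumes "quantum_graph S A" and "quantum_graph T B"
  shows
    "(\<exists>M :: (complex ^ 'h ^ 'k) set.
        TRO M \<and> nondegenerate M \<and> bimodule (commutant B) (commutant A) M \<and>
        M\<^sup>\<star> \<odot> T \<odot> M \<subseteq> S \<and> M \<odot> S \<odot> M\<^sup>\<star> \<subseteq> T \<and>
        M\<^sup>\<star> \<odot> B \<odot> M \<subseteq> A \<and> M \<odot> A \<odot> M\<^sup>\<star> \<subseteq> B)
     \<longleftrightarrow>
     (\<exists>\<phi> :: complex ^ 'k ^ 'k \<Rightarrow> complex ^ 'h ^ 'h.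
        ucp_map B A \<phi> \<and> faithful B \<phi> \<and>
        (kraus_space B A \<phi>)\<^sup>\<star> \<odot> T \<odot> kraus_space B A \<phi> \<subseteq> S \<and>
        kraus_space B A \<phi> \<odot> S \<odot> (kraus_space B A \<phi>)\<^sup>\<star> \<subseteq> T \<and>
        (kraus_space B A \<phi>)\<^sup>\<star> \<odot> B \<odot> kraus_space B A \<phi> \<subseteq> A \<and>
        kraus_space B A \<phi> \<odot> A \<odot> (kraus_space B A \<phi>)\<^sup>\<star> \<subseteq> B)"
    (is "(\<exists>M. ?TRO M) \<longleftrightarrow> (\<exists>\<phi>. ?UCP \<phi>)")
proof
  have B: "op.subspace B" "B\<^sup>\<star> \<subseteq> B" "mat 1 \<in> B" "commutant (commutant B) = B"
      "\<And>x y. x \<in> B \<Longrightarrow> y \<in> B \<Longrightarrow> x ** y \<in> B"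
    and A: "op.subspace A"
    using assms by (simp_all add: quantum_graph_def von_neumann_algebra_def mult_subset_iff)
  {
    assume "\<exists>M. ?TRO M"
    then obtain M where M: "TRO M" "nondegenerate M" "bimodule (commutant B) (commutant A) M"
      and MTM: "M\<^sup>\<star> \<odot> T \<odot> M \<subseteq> S" and MSM: "M \<odot> S \<odot> M\<^sup>\<star> \<subseteq> T"
      and MBM: "M\<^sup>\<star> \<odot> B \<odot> M \<subseteq> A" and MAM: "M \<odot> A \<odot> M\<^sup>\<star> \<subseteq> B" by blast
    have subM: "op.subspace M" using M(1) by (simp add: TRO_def)
    have bim: "b ** m ** a \<in> M" if "b \<in> commutant B" "m \<in> M" "a \<in> commutant A" for b m a
      using M(3) that by (simp add: bimodule_def mult_adj_subset_iff)
    obtain r w where w: "\<And>i. i < (r::nat) \<Longrightarrow> w i \<in> M" "(\<Sum>i<r. cadj (w i) ** w i) = mat 1"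
      "\<And>b :: complex ^ 'k ^ 'k. (\<And>i. i < r \<Longrightarrow> b ** w i = 0) \<Longrightarrow> b = 0"
      using TRO_frame[OF M(1,2)] by blast
    define \<phi> where "\<phi> b = (\<Sum>i<r. cadj (w i) ** b ** w i)" for b
    have kr: "kraus_operators B \<phi> r w" by (simp add: kraus_operators_def \<phi>_def)
    obtain s v where v: "kraus_operators B \<phi> s v" and
      X: "kraus_space B A \<phi> = op.span {b ** v i ** a | b i a. b \<in> commutant B \<and> i < s \<and> a \<in> commutant A}"
      by (rule kraus_space_eq[of B \<phi> A]) (use kr that in blast)+
    \<comment> \<open>The chosen \<open>v\<close> may differ from \<open>w\<close>. The commutant of
      \<open>B\<close> serves as \<open>D\<close>; its commutant is \<open>B\<close> again, so the
      Kraus formula holds on the required domain.\<close>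
    have vM: "v i \<in> M" if "i < s" for i
    proof (rule kraus_in_module[OF subM, of "commutant B" \<phi> r w s v])
      show "b ** y \<in> M" if "b \<in> commutant B" "y \<in> M" for b y
        using bim[OF that one_commutant] by simp
      show "(commutant B)\<^sup>\<star> \<subseteq> commutant B"
        using cadj_commutant[OF B(2)] by (auto simp: star_subset_iff)
    qed (use kr v w that B(4) in auto)
    have XM: "kraus_space B A \<phi> \<subseteq> M"
      unfolding X by (rule op.span_minimal[OF _ subM]) (use vM bim in auto)
    have "ucp_map B A \<phi>"
      unfolding ucp_map_def
    proof (intro conjI)
      show "\<phi> ` B \<subseteq> A"
        using w(1) MBM unfolding \<phi>_def mult_adj_subset_iff
        by (auto intro!: op.subspace_sum[OF A])
      show "completely_positive B \<phi>" by (rule completely_positive_kraus[OF kr B(1)])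
      show "\<phi> (mat 1) = mat 1" using w(2) by (simp add: \<phi>_def)
    qed
    moreover have "faithful B \<phi>"
      unfolding faithful_def
    proof (intro ballI impI)
      fix x :: "complex ^ 'k ^ 'k"
      assume "\<phi> (cadj x ** x) = 0"
      \<comment> \<open>Faithfulness is checked on the constructed \<open>w\<close>, whose joint
        detection property then gives \<open>x = 0\<close>.\<close>
      then have z: "(\<Sum>i<r. cadj (x ** w i) ** (x ** w i)) = 0"
        by (simp add: \<phi>_def cadj_mult matrix_mul_assoc)
      show "x = 0"
      proof (rule w(3))
        show "x ** w i = 0" if "i < r" for i
          using sum_cadj_mult_self_eq_0[OF _ z, of i] that by simp
      qed
    qed
    ultimately have "?UCP \<phi>"
      using MTM MSM MBM MAM XM unfolding mult_adj_subset_iff by (simp add: subset_iff)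
    then show "\<exists>\<phi>. ?UCP \<phi>" by blast
  next
    assume "\<exists>\<phi>. ?UCP \<phi>"
    then obtain \<phi> where \<phi>: "?UCP \<phi>" by blast
    then have cp: "completely_positive B \<phi>" and unital: "\<phi> (mat 1) = mat 1" and
      faith: "faithful B \<phi>" by (simp_all add: ucp_map_def)
    obtain r v where v: "kraus_operators B \<phi> r v" and
      X: "kraus_space B A \<phi> = op.span {b ** v i ** a | b i a. b \<in> commutant B \<and> i < r \<and> a \<in> commutant A}"
      by (rule kraus_space_eq[OF cp_unital_kraus_exists[OF B(1-3) cp unital]])
    have ph: "\<phi> b = (\<Sum>i<r. cadj (v i) ** b ** v i)" if "b \<in> B" for b
      using v that by (simp add: kraus_operators_def)
    have comm_mult: "x ** y \<in> commutant Z" if "x \<in> commutant Z" "y \<in> commutant Z"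
      for x y :: "complex ^ 'z ^ 'z" and Z
      using that unfolding commutant_def by (simp add: matrix_mul_assoc) (metis matrix_mul_assoc)
    show "\<exists>M. ?TRO M"
    proof (rule TRO_of_bimodule[OF assms, of "kraus_space B A \<phi>" r v])
      show "v i \<in> kraus_space B A \<phi>" if "i < r" for i
        unfolding X using kraus_in_span[OF that] .
      show "(\<Sum>i<r. cadj (v i) ** v i) = mat 1" using ph[OF B(3)] unital by simp
      show "b = 0" if "b \<in> B" "\<And>i. i < r \<Longrightarrow> b ** v i = 0" for b
      proof -
        \<comment> \<open>Faithfulness concerns elements of the form \<open>cadj b ** b\<close>; the
          Kraus formula shows that \<open>\<phi>\<close> vanishes there once \<open>b\<close> kills
          every \<open>v i\<close>.\<close>
        have "cadj b ** b \<in> B" using that(1) B by (simp add: star_subset_iff)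
        then have "\<phi> (cadj b ** b) = (\<Sum>i<r. cadj (v i) ** cadj b ** (b ** v i))"
          by (simp add: ph matrix_mul_assoc)
        also have "\<dots> = 0" using that(2) by simp
        finally show ?thesis using faith that(1) by (simp add: faithful_def)
      qed
      fix b x a
      assume b: "b \<in> commutant B" and a: "a \<in> commutant A" and x: "x \<in> kraus_space B A \<phi>"
      show "b ** x ** a \<in> kraus_space B A \<phi>"
        unfolding X
      proof (rule op_span_mult[OF op.subspace_span _ x[unfolded X]])
        fix g assume "g \<in> {b ** v i ** a | b i a. b \<in> commutant B \<and> i < r \<and> a \<in> commutant A}"
        then obtain b' i a' where g: "g = b' ** v i ** a'" "b' \<in> commutant B" "i < r" "a' \<in> commutant A"
          by blast
        have "b ** g ** a = (b ** b') ** v i ** (a' ** a)" by (simp add: g matrix_mul_assoc)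
        then show "b ** g ** a \<in> op.span {b ** v i ** a | b i a. b \<in> commutant B \<and> i < r \<and> a \<in> commutant A}"
          using comm_mult[OF b g(2)] comm_mult[OF g(4) a] g(3) by (intro op.span_base) blast
      qed
    qed (use \<phi> in auto)
  }
qed

end
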